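(* Let $m$ be an infinite cardinal and let $T$ be a tree all of whose vertex degrees are bounded by $2^m$. If the minimum number of vertices moved by each non-identity automorphism of $T$ is $m$ (i.e. the motion of $T$ is $m$), then $T$ is asymmetrizable and the number of pairwise inequivalent asymmetrizing sets of $T$ is $2^{|T|}$.
   Context: For a graph $G$, a set $S\subseteq V(G)$ is asymmetrizing if the identity is the only automorphism of $G$ mapping $S$ onto itself setwise; $G$ is asymmetrizable if it has an asymmetrizing set ($S$ may be empty or all of $V(G)$). Two asymmetrizing sets $S,S'$ of $G$ are equivalent if some automorphism $\varphi$ of $G$ satisfies $\varphi(S)=S'$. The motion of $G$ is the least number of vertices moved by a non-identity automorphism of $G$; by convention an asymmetric graph has motion larger than every cardinal. $|T|$ denotes the number of vertices of $T$. *)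

theory Defs
  imports Main
begin

unbundle cardinal_syntax

text \<open>
  A graph is given by its vertex set \<open>V\<close>, of arbitrary cardinality, and its
  adjacency relation \<open>E\<close>; an undirected edge \<open>uv\<close> is the presence of both
  \<open>(u, v)\<close> and \<open>(v, u)\<close> in \<open>E\<close>.
\<close>

definition simple_graph :: "'a set \<Rightarrow> 'a rel \<Rightarrow> bool" where
  "simple_graph V E \<longleftrightarrow> E \<subseteq> V \<times> V \<and> sym E \<and> irrefl E"

definition connected_graph :: "'a set \<Rightarrow> 'a rel \<Rightarrow> bool" where
  "connected_graph V E \<longleftrightarrow> V \<noteq> {} \<and> (\<forall>u\<in>V. \<forall>v\<in>V. (u, v) \<in> E\<^sup>*)"

text \<open>
  A cycle is listed without repeating its first vertex. The length bound keeps a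
  single edge, traversed back and forth, from counting as a cycle.
\<close>

definition graph_cycle :: "'a rel \<Rightarrow> 'a list \<Rightarrow> bool" where
  "graph_cycle E vs \<longleftrightarrow>
     3 \<le> length vs \<and> distinct vs \<and>
     successively (\<lambda>u v. (u, v) \<in> E) vs \<and> (last vs, hd vs) \<in> E"

definition tree :: "'a set \<Rightarrow> 'a rel \<Rightarrow> bool" where
  "tree V E \<longleftrightarrow> simple_graph V E \<and> connected_graph V E \<and> (\<nexists>vs. graph_cycle E vs)"

definition neighbours :: "'a rel \<Rightarrow> 'a \<Rightarrow> 'a set" where
  "neighbours E v = {u. (v, u) \<in> E}"

text \<open>
  Automorphisms are HOL functions whose values outside \<open>V\<close> are irrelevant; being
  the identity therefore means \<open>\<forall>v\<in>V. \<phi> v = v\<close>, i.e. moving no vertex.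
\<close>

definition automorphism :: "'a set \<Rightarrow> 'a rel \<Rightarrow> ('a \<Rightarrow> 'a) \<Rightarrow> bool" where
  "automorphism V E \<phi> \<longleftrightarrow>
     bij_betw \<phi> V V \<and> (\<forall>u\<in>V. \<forall>v\<in>V. (\<phi> u, \<phi> v) \<in> E \<longleftrightarrow> (u, v) \<in> E)"

definition moved :: "'a set \<Rightarrow> ('a \<Rightarrow> 'a) \<Rightarrow> 'a set" where
  "moved V \<phi> = {v \<in> V. \<phi> v \<noteq> v}"

text \<open>
  \<open>has_motion V E m\<close>: the cardinal \<open>m\<close> is the least number of vertices moved by a
  non-identity automorphism. It holds for no \<open>m\<close> if the graph is asymmetric, in
  agreement with the convention that the motion then exceeds every cardinal.
\<close>

definition has_motion :: "'a set \<Rightarrow> 'a rel \<Rightarrow> 'b rel \<Rightarrow> bool" where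
  "has_motion V E m \<longleftrightarrow>
     (\<exists>\<phi>. automorphism V E \<phi> \<and> moved V \<phi> \<noteq> {} \<and> |moved V \<phi>| =o m) \<and>
     (\<forall>\<phi>. automorphism V E \<phi> \<and> moved V \<phi> \<noteq> {} \<longrightarrow> m \<le>o |moved V \<phi>| )"

definition asymmetrizing :: "'a set \<Rightarrow> 'a rel \<Rightarrow> 'a set \<Rightarrow> bool" where
  "asymmetrizing V E S \<longleftrightarrow>
     S \<subseteq> V \<and> (\<forall>\<phi>. automorphism V E \<phi> \<and> \<phi> ` S = S \<longrightarrow> (\<forall>v\<in>V. \<phi> v = v))"

definition asymmetrizable :: "'a set \<Rightarrow> 'a rel \<Rightarrow> bool" where
  "asymmetrizable V E \<longleftrightarrow> (\<exists>S. asymmetrizing V E S)"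

definition asym_sets :: "'a set \<Rightarrow> 'a rel \<Rightarrow> 'a set set" where
  "asym_sets V E = {S. asymmetrizing V E S}"

definition asym_equiv :: "'a set \<Rightarrow> 'a rel \<Rightarrow> 'a set rel" where
  "asym_equiv V E =
     {(S, S'). S \<in> asym_sets V E \<and> S' \<in> asym_sets V E \<and>
               (\<exists>\<phi>. automorphism V E \<phi> \<and> \<phi> ` S = S')}"

lemma automorphism_id: "automorphism V E id"
  by (simp add: automorphism_def)

lemma automorphism_comp:
  assumes "automorphism V E \<phi>" "automorphism V E \<psi>"
  shows "automorphism V E (\<psi> \<circ> \<phi>)"
  using assms bij_betwE[of \<phi> V V] unfolding automorphism_def
  by (auto intro: bij_betw_trans)

lemma automorphism_inv:
  assumes "automorphism V E \<phi>"
  shows "automorphism V E (inv_into V \<phi>)"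
proof -
  have bij: "bij_betw \<phi> V V" using assms by (simp add: automorphism_def)
  then have bij': "bij_betw (inv_into V \<phi>) V V" by (rule bij_betw_inv_into)
  have "(inv_into V \<phi> u, inv_into V \<phi> v) \<in> E \<longleftrightarrow> (u, v) \<in> E" if "u \<in> V" "v \<in> V" for u v
    using that assms bij_betwE[OF bij'] bij_betw_inv_into_right[OF bij]
    unfolding automorphism_def by metis
  with bij' show ?thesis by (simp add: automorphism_def)
qed

lemma equiv_asym_equiv: "equiv (asym_sets V E) (asym_equiv V E)"
proof (rule equivI)
  show "asym_equiv V E \<subseteq> asym_sets V E \<times> asym_sets V E"
    by (auto simp: asym_equiv_def)
  show "refl_on (asym_sets V E) (asym_equiv V E)"
    by (auto simp: refl_on_def asym_equiv_def intro!: exI[of _ id] automorphism_id)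
  show "sym (asym_equiv V E)"
  proof (rule symI)
    fix S S' assume "(S, S') \<in> asym_equiv V E"
    then obtain \<phi> where S: "S \<in> asym_sets V E" "S' \<in> asym_sets V E"
      and \<phi>: "automorphism V E \<phi>" "\<phi> ` S = S'" by (auto simp: asym_equiv_def)
    have "inv_into V \<phi> ` S' = S"
      using S \<phi> inv_into_image_cancel[of \<phi> V S]
      by (auto simp: automorphism_def bij_betw_def asym_sets_def asymmetrizing_def)
    with S automorphism_inv[OF \<phi>(1)] show "(S', S) \<in> asym_equiv V E"
      by (auto simp: asym_equiv_def)
  qed
  show "trans (asym_equiv V E)"
  proof (rule transI)
    fix S S' S'' assume "(S, S') \<in> asym_equiv V E" "(S', S'') \<in> asym_equiv V E"
    then obtain \<phi> \<psi> where S: "S \<in> asym_sets V E" "S'' \<in> asym_sets V E"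
      and \<phi>: "automorphism V E \<phi>" "\<phi> ` S = S'"
      and \<psi>: "automorphism V E \<psi>" "\<psi> ` S' = S''" by (auto simp: asym_equiv_def)
    have "(\<psi> \<circ> \<phi>) ` S = S''" using \<phi>(2) \<psi>(2) by auto
    with S automorphism_comp[OF \<phi>(1) \<psi>(1)] show "(S, S'') \<in> asym_equiv V E"
      unfolding asym_equiv_def by blast
  qed
qed

end

theory Submission
  imports Defs
begin

text \<open>
  Root the tree at \<open>r\<close> and call a vertex \<open>x\<close> good if its branch has a family of sets of odd
  vertices, indexed by all such sets, in which different members are inequivalent and every
  member is asymmetrizing. Isomorphic sibling branches are large by the motion assumption,
  and few by the degree bound; hence if all children are good, they can be given pairwise
  inequivalent sets, and the parent is good.

  The bad vertices are treated all at once. Starting from a bad vertex, follow bad children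
  only; take such a core \<open>X\<close> of least cardinality, so that every bad vertex in it again has
  a core of size \<open>|X|\<close>. Choose a sparse set of nodes in \<open>X\<close>, label them by elements of the
  well-ordered set \<open>X\<close>, and colour so that the labels of the flagged nodes next below a
  node with label \<open>a\<close> are precisely those smaller than \<open>a\<close>. By induction the colouring
  determines all labels, and nodes which could be interchanged get different labels. So
  all nodes, and therefore all of \<open>X\<close>, are fixed, and the initial vertex is good after all.

  Finally colour \<open>r\<close> as the only even vertex. Then automorphisms preserving the colouring
  respect parity and fix \<open>r\<close>.
\<close>

section \<open>Rooted trees and isomorphisms of branches\<close>

text \<open>Edges are absent at this stage: the parent map carries the tree, and \<open>dep\<close>
  makes climbing well-founded. Values of \<open>par\<close> at \<open>r\<close> and outside
  \<open>V\<close> are arbitrary, hence the guards \<open>w \<in> V\<close> and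
  \<open>w \<noteq> r\<close> below.\<close>

locale rooted_tree =
  fixes V :: "'a set" and r :: 'a and par :: "'a \<Rightarrow> 'a" and dep :: "'a \<Rightarrow> nat"
  assumes root_in: "r \<in> V"
    and dep_root: "dep r = 0"
    and par_in: "\<And>v. v \<in> V \<Longrightarrow> v \<noteq> r \<Longrightarrow> par v \<in> V"
    and dep_par: "\<And>v. v \<in> V \<Longrightarrow> v \<noteq> r \<Longrightarrow> dep v = Suc (dep (par v))"
begin

inductive_set branch :: "'a \<Rightarrow> 'a set" for x where
  branch_base: "x \<in> branch x"
| branch_step: "par w \<in> branch x \<Longrightarrow> w \<in> V \<Longrightarrow> w \<noteq> r \<Longrightarrow> w \<in> branch x"

definition children :: "'a \<Rightarrow> 'a set" where
  "children v = {w \<in> V. w \<noteq> r \<and> par w = v}"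

lemma branch_in: "v \<in> branch x \<Longrightarrow> x \<in> V \<Longrightarrow> v \<in> V"
  by (induction rule: branch.induct) auto

lemma branch_dep: "v \<in> branch x \<Longrightarrow> x \<in> V \<Longrightarrow> v = x \<or> dep x < dep v"
  by (induction rule: branch.induct) (auto simp: dep_par)

lemma branch_dep_le: "v \<in> branch x \<Longrightarrow> x \<in> V \<Longrightarrow> dep x \<le> dep v"
  using branch_dep by fastforce

lemma branch_par: "v \<in> branch x \<Longrightarrow> v \<noteq> x \<Longrightarrow> v \<in> V \<and> v \<noteq> r \<and> par v \<in> branch x"
  by (erule branch.cases) auto

lemma branch_trans: "v \<in> branch z \<Longrightarrow> z \<in> branch x \<Longrightarrow> v \<in> branch x"
  by (induction rule: branch.induct) (auto intro: branch.intros)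

text \<open>Climbing from a vertex is deterministic, so its ancestors form a chain.\<close>

lemma branch_comparable: "v \<in> branch z \<Longrightarrow> v \<in> branch z' \<Longrightarrow> z \<in> branch z' \<or> z' \<in> branch z"
proof (induction rule: branch.induct)
  case (branch_step w)
  then show ?case
    using branch_par[of w z'] branch.branch_step[of w z] by auto
qed auto

lemma branch_antisym: "v \<in> branch z \<Longrightarrow> z \<in> branch v \<Longrightarrow> z \<in> V \<Longrightarrow> v = z"
  using branch_dep branch_in by (metis less_asym)

lemma branch_root: "v \<in> V \<Longrightarrow> v \<in> branch r"
proof (induction "dep v" arbitrary: v)
  case 0
  then have "v = r" using dep_par by fastforce
  then show ?case by (simp add: branch_base)
next
  case (Suc n)
  then show ?case
    by (metis branch.intros dep_par dep_root nat.inject par_in Zero_not_Suc)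
qed

lemma branch_root_eq: "branch r = V"
  using branch_root branch_in root_in by blast

lemma children_branch: "w \<in> children v \<Longrightarrow> v \<in> branch x \<Longrightarrow> w \<in> branch x"
  by (auto simp: children_def intro: branch_step)

lemma children_dep: "w \<in> children v \<Longrightarrow> dep w = Suc (dep v)"
  by (auto simp: children_def dep_par)

lemma sibling_branch_disjoint:
  assumes "z \<in> children p" "z' \<in> children p" "z \<noteq> z'"
  shows "branch z \<inter> branch z' = {}"
proof (rule ccontr)
  assume "branch z \<inter> branch z' \<noteq> {}"
  then have "z \<in> branch z' \<or> z' \<in> branch z" using branch_comparable by blast
  then show False
    using branch_dep[of z z'] branch_dep[of z' z] assms children_dep by (auto simp: children_def)
qed

text \<open>The parity clause makes isomorphisms respect the set of odd vertices below.\<close>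

definition branch_iso :: "'a \<Rightarrow> 'a \<Rightarrow> ('a \<Rightarrow> 'a) \<Rightarrow> bool" where
  "branch_iso x y f \<longleftrightarrow> x \<in> V \<and> y \<in> V \<and> bij_betw f (branch x) (branch y) \<and> f x = y \<and>
     (\<forall>v\<in>branch x. v \<noteq> x \<longrightarrow> f (par v) = par (f v)) \<and> even (dep x + dep y)"

lemma iso_in: "branch_iso x y f \<Longrightarrow> x \<in> V \<and> y \<in> V \<and> f x = y"
  by (simp add: branch_iso_def)

lemma iso_mem: "branch_iso x y f \<Longrightarrow> v \<in> branch x \<Longrightarrow> f v \<in> branch y"
  by (auto simp: branch_iso_def bij_betw_def)

lemma iso_inj: "branch_iso x y f \<Longrightarrow> inj_on f (branch x)"
  by (simp add: branch_iso_def bij_betw_def)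

lemma iso_eq_base: "branch_iso x y f \<Longrightarrow> v \<in> branch x \<Longrightarrow> f v = y \<longleftrightarrow> v = x"
  using branch_base by (fastforce simp: branch_iso_def bij_betw_def inj_on_def)

lemma iso_par: "branch_iso x y f \<Longrightarrow> v \<in> branch x \<Longrightarrow> v \<noteq> x \<Longrightarrow> f (par v) = par (f v)"
  by (simp add: branch_iso_def)

text \<open>Since \<open>f\<close> commutes with \<open>par\<close>, it shifts all depths by the
  same amount; the additive form avoids subtraction of naturals.\<close>

lemma iso_dep: "branch_iso x y f \<Longrightarrow> v \<in> branch x \<Longrightarrow> dep (f v) + dep x = dep v + dep y"
proof (induction "dep v" arbitrary: v rule: less_induct)
  case less
  show ?case
  proof (cases "v = x")
    case True
    then show ?thesis using less iso_in by auto
  next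
    case False
    then have v: "v \<in> V" "v \<noteq> r" "par v \<in> branch x" using branch_par less by auto
    have "f v \<noteq> y" using False less iso_eq_base by blast
    then have fv: "f v \<in> V" "f v \<noteq> r" using branch_par[of "f v" y] iso_mem less by auto
    have "dep (f (par v)) + dep x = dep (par v) + dep y"
      using less v dep_par by simp
    then show ?thesis
      using iso_par[OF less(2,3) False] dep_par[OF v(1,2)] dep_par[OF fv] by simp
  qed
qed

lemma iso_parity: "branch_iso x y f \<Longrightarrow> v \<in> branch x \<Longrightarrow> even (dep (f v)) \<longleftrightarrow> even (dep v)"
proof -
  assume *: "branch_iso x y f" "v \<in> branch x"
  then have "even (dep x + dep y)" by (simp add: branch_iso_def)
  then show ?thesis using iso_dep[OF *] by (metis even_add)
qed

lemma iso_id: "x \<in> V \<Longrightarrow> branch_iso x x id"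
  by (auto simp: branch_iso_def)

lemma iso_comp:
  assumes "branch_iso x y f" "branch_iso y z g"
  shows "branch_iso x z (g \<circ> f)"
proof -
  have "g (f (par v)) = par (g (f v))" if "v \<in> branch x" "v \<noteq> x" for v
    using that assms iso_par iso_mem iso_eq_base by metis
  moreover have "even (dep x + dep z)" using assms by (auto simp: branch_iso_def)
  ultimately show ?thesis using assms by (auto simp: branch_iso_def intro: bij_betw_trans)
qed

lemma iso_inv:
  assumes "branch_iso x y f"
  shows "branch_iso y x (inv_into (branch x) f)"
proof -
  let ?g = "inv_into (branch x) f"
  have bij: "bij_betw f (branch x) (branch y)" using assms by (simp add: branch_iso_def)
  have gb: "bij_betw ?g (branch y) (branch x)" using bij_betw_inv_into[OF bij] .
  have gx: "?g y = x"
    using assms branch_base inv_into_f_eq[OF iso_inj[OF assms]] by (metis iso_in)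
  have "?g (par w) = par (?g w)" if w: "w \<in> branch y" "w \<noteq> y" for w
  proof -
    let ?v = "?g w"
    have v: "?v \<in> branch x" "f ?v = w"
      using w gb bij_betw_inv_into_right[OF bij] by (auto simp: bij_betw_def)
    have "?v \<noteq> x" using v w assms iso_in by metis
    then have "f (par ?v) = par w" "par ?v \<in> branch x"
      using iso_par[OF assms v(1)] v branch_par by auto
    then show ?thesis using inv_into_f_eq[OF iso_inj[OF assms]] by metis
  qed
  then show ?thesis using gb gx assms by (auto simp: branch_iso_def)
qed

lemma iso_inv_apply:
  assumes "branch_iso x y f"
  shows "v \<in> branch x \<Longrightarrow> inv_into (branch x) f (f v) = v"
    and "w \<in> branch y \<Longrightarrow> f (inv_into (branch x) f w) = w"
  using assms by (auto simp: branch_iso_def bij_betw_inv_into_left bij_betw_inv_into_right)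

lemma iso_branch:
  assumes "branch_iso x y f" "z \<in> branch x" "v \<in> branch z"
  shows "f v \<in> branch (f z)"
  using assms(3)
proof (induction rule: branch.induct)
  case (branch_step w)
  have w: "w \<in> branch x" using branch_step assms branch_trans branch.branch_step by metis
  show ?case
  proof (cases "w = x")
    case True
    then have "x \<noteq> r" "par x \<in> branch x"
      using branch_step assms(2) branch_trans by auto
    then show ?thesis using branch_dep[of "par x" x] dep_par[of x] iso_in[OF assms(1)] by auto
  next
    case False
    then have "f w \<noteq> y" using iso_eq_base assms(1) w by metis
    then have "f w \<in> V" "f w \<noteq> r" using branch_par[of "f w" y] iso_mem[OF assms(1) w] by auto
    then show ?thesis
      using branch_step iso_par[OF assms(1) w False] branch.branch_step by metis
  qed
qed (rule branch_base)

text \<open>Descendants go to descendants by \<open>iso_branch\<close>; the same lemma for the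
  inverse map gives surjectivity onto \<open>branch (f z)\<close>.\<close>

lemma iso_restrict:
  assumes "branch_iso x y f" "z \<in> branch x"
  shows "branch_iso z (f z) f"
proof -
  let ?g = "inv_into (branch x) f"
  have "f ` branch z = branch (f z)"
  proof
    show "f ` branch z \<subseteq> branch (f z)" using iso_branch[OF assms] by auto
    show "branch (f z) \<subseteq> f ` branch z"
    proof
      fix w assume w: "w \<in> branch (f z)"
      have "?g w \<in> branch (?g (f z))"
        using iso_branch[OF iso_inv[OF assms(1)] iso_mem[OF assms] w] .
      then have "?g w \<in> branch z" using iso_inv_apply[OF assms(1)] assms(2) by auto
      moreover have "f (?g w) = w"
        using iso_inv_apply(2)[OF assms(1)] branch_trans[OF w iso_mem[OF assms]] .
      ultimately show "w \<in> f ` branch z" by (metis imageI)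
    qed
  qed
  moreover have "inj_on f (branch z)"
    using iso_inj[OF assms(1)] branch_trans[OF _ assms(2)] by (auto simp: inj_on_def)
  moreover have "f (par v) = par (f v)" if "v \<in> branch z" "v \<noteq> z" for v
  proof -
    have "v \<noteq> x" using that assms branch_antisym[of z x] iso_in by metis
    then show ?thesis using iso_par[OF assms(1)] branch_trans[OF that(1) assms(2)] by blast
  qed
  moreover have "z \<in> V" "f z \<in> V"
    using assms branch_in iso_mem iso_in by metis+
  moreover have "even (dep z + dep (f z))" using iso_parity[OF assms] by auto
  ultimately show ?thesis by (simp add: branch_iso_def bij_betw_def)
qed

lemma iso_children:
  assumes "branch_iso x y f" "v \<in> branch x" "w \<in> children v"
  shows "f w \<in> children (f v)"
proof -
  have w: "w \<in> branch x" "par w = v" using assms children_branch by (auto simp: children_def)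
  have "w \<noteq> x" using branch_dep_le[OF assms(2)] children_dep[OF assms(3)] iso_in[OF assms(1)] by auto
  moreover from this have "f w \<noteq> y" using iso_eq_base assms(1) w by metis
  then have "f w \<in> V" "f w \<noteq> r" using branch_par[of "f w" y] iso_mem[OF assms(1) w(1)] by auto
  ultimately show ?thesis using iso_par[OF assms(1) w(1)] w(2) by (auto simp: children_def)
qed

section \<open>Rigid codings and good vertices\<close>

definition odds :: "'a set" where "odds = {v. odd (dep v)}"

text \<open>One implication serves two purposes: \<open>A = A'\<close> makes differently indexed
  sets inequivalent, and for equal indices the other conclusion makes each set rigid under
  self-isomorphisms of the branch. Indexing by all sets of odd vertices supplies the number of
  codings that is later shared among twins and counted at the root.\<close>

definition rigid_coding :: "'a \<Rightarrow> ('a set \<Rightarrow> 'a set) \<Rightarrow> bool" where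
  "rigid_coding x S \<longleftrightarrow>
     (\<forall>A. A \<subseteq> branch x \<inter> odds \<longrightarrow> S A \<subseteq> branch x \<inter> odds) \<and>
     (\<forall>A A' f. A \<subseteq> branch x \<inter> odds \<longrightarrow> A' \<subseteq> branch x \<inter> odds \<longrightarrow> branch_iso x x f \<longrightarrow>
        f ` S A = S A' \<longrightarrow> A = A' \<and> (\<forall>v\<in>branch x. f v = v))"

lemma rigid_codingI:
  assumes "\<And>A. A \<subseteq> branch x \<inter> odds \<Longrightarrow> S A \<subseteq> branch x \<inter> odds"
    and "\<And>A A' f. A \<subseteq> branch x \<inter> odds \<Longrightarrow> A' \<subseteq> branch x \<inter> odds \<Longrightarrow> branch_iso x x f \<Longrightarrow>
        f ` S A = S A' \<Longrightarrow> A = A' \<and> (\<forall>v\<in>branch x. f v = v)"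
  shows "rigid_coding x S"
  using assms by (simp add: rigid_coding_def)

lemma rigid_coding_odds:
  "rigid_coding x S \<Longrightarrow> A \<subseteq> branch x \<inter> odds \<Longrightarrow> S A \<subseteq> branch x \<inter> odds"
  by (simp add: rigid_coding_def)

lemma rigid_codingD:
  "rigid_coding x S \<Longrightarrow> A \<subseteq> branch x \<inter> odds \<Longrightarrow> A' \<subseteq> branch x \<inter> odds \<Longrightarrow> branch_iso x x f \<Longrightarrow>
     f ` S A = S A' \<Longrightarrow> A = A' \<and> (\<forall>v\<in>branch x. f v = v)"
  unfolding rigid_coding_def by (drule conjunct2) presburger

definition good :: "'a \<Rightarrow> bool" where
  "good x \<longleftrightarrow> (\<exists>S. rigid_coding x S)"

lemma iso_odds_image:
  assumes "branch_iso x y f" "A \<subseteq> branch x \<inter> odds"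
  shows "f ` A \<subseteq> branch y \<inter> odds"
  using assms iso_mem iso_parity by (fastforce simp: odds_def)

lemma iso_inv_image:
  assumes "branch_iso x y f"
  shows "A \<subseteq> branch x \<Longrightarrow> inv_into (branch x) f ` f ` A = A"
    and "B \<subseteq> branch y \<Longrightarrow> f ` inv_into (branch x) f ` B = B"
  using iso_inv_apply[OF assms] by (force simp: image_image subset_iff)+

text \<open>A coding of \<open>branch x\<close> is conjugated by the isomorphism; preservation of
  parity keeps the sets inside \<open>odds\<close>.\<close>

lemma good_transport:
  assumes "good x" "branch_iso x y f"
  shows "good y"
proof -
  let ?g = "inv_into (branch x) f"
  have g: "branch_iso y x ?g" using iso_inv[OF assms(2)] .
  obtain S where S: "rigid_coding x S" using assms(1) good_def by blast
  define S' where "S' A = f ` S (?g ` A)" for A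
  have "rigid_coding y S'"
  proof (rule rigid_codingI)
    fix A assume "A \<subseteq> branch y \<inter> odds"
    then show "S' A \<subseteq> branch y \<inter> odds"
      unfolding S'_def
      by (intro iso_odds_image[OF assms(2)] rigid_coding_odds[OF S] iso_odds_image[OF g])
  next
    fix A A' h
    assume A: "A \<subseteq> branch y \<inter> odds" "A' \<subseteq> branch y \<inter> odds" and h: "branch_iso y y h"
      and im: "h ` S' A = S' A'"
    have A1: "?g ` A \<subseteq> branch x \<inter> odds" "?g ` A' \<subseteq> branch x \<inter> odds"
      using iso_odds_image[OF g] A by blast+
    have k: "branch_iso x x (?g \<circ> (h \<circ> f))"
      using iso_comp[OF iso_comp[OF assms(2) h] g] .
    have "(?g \<circ> (h \<circ> f)) ` S (?g ` A) = ?g ` h ` S' A" by (simp only: S'_def image_comp comp_assoc)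
    also have "\<dots> = S (?g ` A')"
      unfolding im unfolding S'_def
      by (rule iso_inv_image(1)[OF assms(2)]) (use rigid_coding_odds[OF S A1(2)] in simp)
    finally have "?g ` A = ?g ` A' \<and> (\<forall>v\<in>branch x. (?g \<circ> (h \<circ> f)) v = v)"
      by (rule rigid_codingD[OF S A1 k])
    then have c: "?g ` A = ?g ` A'" "\<And>v. v \<in> branch x \<Longrightarrow> ?g (h (f v)) = v" by simp_all
    have "f ` ?g ` A = A" "f ` ?g ` A' = A'"
      by (rule iso_inv_image(2)[OF assms(2)]; use A in simp)+
    then have "A = A'" using c(1) by metis
    moreover have "h w = w" if w: "w \<in> branch y" for w
    proof -
      have "?g w \<in> branch x" "f (?g w) = w"
        using iso_mem[OF g w] iso_inv_apply(2)[OF assms(2) w] by auto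
      then have "?g (h w) = ?g w" using c(2)[of "?g w"] by simp
      then show ?thesis by (rule inj_onD[OF iso_inj[OF g] _ iso_mem[OF h w] w])
    qed
    ultimately show "A = A' \<and> (\<forall>v\<in>branch y. h v = v)" by auto
  qed
  then show ?thesis using good_def by blast
qed

end

section \<open>Combining codings of disjoint branches\<close>

text \<open>All that \<open>all_good\<close> uses of motion and degrees. Only siblings with
  isomorphic branches can be exchanged, so only these are constrained in size and number.\<close>

locale twin_bounded_tree = rooted_tree +
  assumes twins: "\<And>p z z' f. z \<in> children p \<Longrightarrow> z' \<in> children p \<Longrightarrow> z \<noteq> z' \<Longrightarrow> branch_iso z z' f \<Longrightarrow>
      infinite (branch z \<inter> odds) \<and> |children p| \<le>o |Pow (branch z \<inter> odds)|"
begin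

definition twin_class :: "'a \<Rightarrow> 'a set" where
  "twin_class z = {w \<in> children (par z). \<exists>f. branch_iso z w f}"

lemma twin_class_self: "z \<in> V \<Longrightarrow> z \<noteq> r \<Longrightarrow> z \<in> twin_class z"
  using iso_id by (auto simp: twin_class_def children_def)

lemma twin_class_eq:
  assumes "w \<in> twin_class z"
  shows "twin_class w = twin_class z"
proof -
  obtain f where f: "branch_iso z w f" and w: "par w = par z"
    using assms by (auto simp: twin_class_def children_def)
  have "(\<exists>g. branch_iso w u g) \<longleftrightarrow> (\<exists>g. branch_iso z u g)" for u
    using iso_comp[OF f] iso_comp[OF iso_inv[OF f]] by blast
  then show ?thesis by (simp add: twin_class_def w)
qed

text \<open>If the class has a second member, the branch has infinitely many odd vertices, say
  kappa, the class has at most \<open>2^kappa\<close> members, and the product is absorbed. For a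
  class of one member, where the branch may be finite, the projection \<open>snd\<close> does
  it.\<close>

lemma twin_class_injection:
  assumes "w \<in> V" "w \<noteq> r"
  shows "\<exists>j. inj_on j (twin_class w \<times> Pow (branch w \<inter> odds)) \<and>
    j ` (twin_class w \<times> Pow (branch w \<inter> odds)) \<subseteq> Pow (branch w \<inter> odds)"
proof (cases "twin_class w = {w}")
  case True
  then show ?thesis by (intro exI[of _ snd]) (auto simp: inj_on_def)
next
  case False
  then obtain u f where "u \<in> children (par w)" "u \<noteq> w" "branch_iso w u f"
    using twin_class_self[OF assms] by (auto simp: twin_class_def)
  moreover have "w \<in> children (par w)" using assms by (simp add: children_def)
  ultimately have inf: "infinite (branch w \<inter> odds)"
    and le: "|children (par w)| \<le>o |Pow (branch w \<inter> odds)|"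
    using twins[of w "par w" u f] by auto
  have "|twin_class w| \<le>o |Pow (branch w \<inter> odds)|"
    using card_of_mono1[of "twin_class w" "children (par w)"] le ordLeq_transitive
    by (auto simp: twin_class_def)
  moreover have "infinite (Pow (branch w \<inter> odds))" using inf finite_Pow_iff by blast
  ultimately have "|twin_class w \<times> Pow (branch w \<inter> odds)| \<le>o |Pow (branch w \<inter> odds)|"
    using card_of_Times_infinite[of "Pow (branch w \<inter> odds)" "twin_class w"]
      twin_class_self[OF assms] ordIso_imp_ordLeq by blast
  then show ?thesis by (simp only: card_of_ordLeq)
qed

text \<open>The comparison also runs between different siblings, so one \<open>H\<close>
  distinguishes the good children of a vertex and makes each of their branches rigid.\<close>

definition sibling_coding :: "('a \<Rightarrow> 'a set \<Rightarrow> 'a set) \<Rightarrow> bool" where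
  "sibling_coding H \<longleftrightarrow>
     (\<forall>z A. z \<in> V \<longrightarrow> z \<noteq> r \<longrightarrow> good z \<longrightarrow> A \<subseteq> branch z \<inter> odds \<longrightarrow> H z A \<subseteq> branch z \<inter> odds) \<and>
     (\<forall>z z' A A' f. z \<in> V \<longrightarrow> z \<noteq> r \<longrightarrow> good z \<longrightarrow> z' \<in> V \<longrightarrow> z' \<noteq> r \<longrightarrow> par z = par z' \<longrightarrow>
       A \<subseteq> branch z \<inter> odds \<longrightarrow> A' \<subseteq> branch z' \<inter> odds \<longrightarrow> branch_iso z z' f \<longrightarrow>
       f ` H z A = H z' A' \<longrightarrow> z = z' \<and> A = A' \<and> (\<forall>v\<in>branch z. f v = v))"

lemma sibling_coding_odds:
  "sibling_coding H \<Longrightarrow> z \<in> V \<Longrightarrow> z \<noteq> r \<Longrightarrow> good z \<Longrightarrow> A \<subseteq> branch z \<inter> odds \<Longrightarrow>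
     H z A \<subseteq> branch z \<inter> odds"
  by (simp add: sibling_coding_def)

lemma sibling_codingD:
  "sibling_coding H \<Longrightarrow> z \<in> V \<Longrightarrow> z \<noteq> r \<Longrightarrow> good z \<Longrightarrow> z' \<in> V \<Longrightarrow> z' \<noteq> r \<Longrightarrow> par z = par z' \<Longrightarrow>
     A \<subseteq> branch z \<inter> odds \<Longrightarrow> A' \<subseteq> branch z' \<inter> odds \<Longrightarrow> branch_iso z z' f \<Longrightarrow>
     f ` H z A = H z' A' \<Longrightarrow> z = z' \<and> A = A' \<and> (\<forall>v\<in>branch z. f v = v)"
  unfolding sibling_coding_def by (drule conjunct2) presburger

text \<open>
  Twins share a representative branch; the codings of the latter are split among the
  members of the twin class, which are few enough for each to receive a full share.
\<close>

lemma ex_sibling_coding: "\<exists>H. sibling_coding H"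
proof -
  \<comment> \<open>The choice is made from the class as a set; twins have equal classes and hence
    the same representative.\<close>
  define rep where "rep z = (SOME w. w \<in> twin_class z)" for z
  define \<psi> where "\<psi> z = (SOME f. branch_iso z (rep z) f)" for z
  define S where "S w = (SOME S. rigid_coding w S)" for w
  define j where "j w = (SOME j. inj_on j (twin_class w \<times> Pow (branch w \<inter> odds)) \<and>
    j ` (twin_class w \<times> Pow (branch w \<inter> odds)) \<subseteq> Pow (branch w \<inter> odds))" for w
  define \<psi>' where "\<psi>' z = inv_into (branch z) (\<psi> z)" for z
  \<comment> \<open>The pair of a twin and a subset, the latter carried to the representative
    branch, is merged by \<open>j\<close> into a single index there.\<close>
  define I where "I z A = j (rep z) (z, \<psi> z ` A)" for z A
  define H where "H z A = \<psi>' z ` S (rep z) (I z A)" for z A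

  have rep: "rep z \<in> twin_class z" if "z \<in> V" "z \<noteq> r" for z
    unfolding rep_def using twin_class_self[OF that] by (rule someI)
  have rep': "rep z \<in> V" "rep z \<noteq> r" if "z \<in> V" "z \<noteq> r" for z
    using rep[OF that] by (auto simp: twin_class_def children_def)
  have rep'': "twin_class (rep z) = twin_class z" if "z \<in> V" "z \<noteq> r" for z
    by (rule twin_class_eq[OF rep[OF that]])
  have \<psi>: "branch_iso z (rep z) (\<psi> z)" if "z \<in> V" "z \<noteq> r" for z
  proof -
    have "\<exists>f. branch_iso z (rep z) f" using rep[OF that] by (simp add: twin_class_def)
    then show ?thesis unfolding \<psi>_def by (rule someI_ex)
  qed
  have \<psi>': "branch_iso (rep z) z (\<psi>' z)" if "z \<in> V" "z \<noteq> r" for z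
    unfolding \<psi>'_def by (rule iso_inv[OF \<psi>[OF that]])
  have S: "rigid_coding w (S w)" if "good w" for w
  proof -
    have "\<exists>S. rigid_coding w S" using that by (simp add: good_def)
    then show ?thesis unfolding S_def by (rule someI_ex)
  qed
  have j: "inj_on (j w) (twin_class w \<times> Pow (branch w \<inter> odds))"
      "j w ` (twin_class w \<times> Pow (branch w \<inter> odds)) \<subseteq> Pow (branch w \<inter> odds)"
    if "w \<in> V" "w \<noteq> r" for w
    using someI_ex[OF twin_class_injection[OF that]] unfolding j_def by blast+
  have I: "I z A \<subseteq> branch (rep z) \<inter> odds"
    if "z \<in> V" "z \<noteq> r" "A \<subseteq> branch z \<inter> odds" for z A
  proof -
    have "(z, \<psi> z ` A) \<in> twin_class (rep z) \<times> Pow (branch (rep z) \<inter> odds)"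
      using iso_odds_image[OF \<psi>[OF that(1,2)] that(3)] twin_class_self[OF that(1,2)]
        rep''[OF that(1,2)] by (intro SigmaI PowI) simp_all
    then show ?thesis using j(2)[OF rep'(1,2)[OF that(1,2)]] unfolding I_def by blast
  qed
  have good_rep: "good (rep z)" if "z \<in> V" "z \<noteq> r" "good z" for z
    by (rule good_transport[OF that(3) \<psi>[OF that(1,2)]])

  have "sibling_coding H"
    unfolding sibling_coding_def
  proof (intro conjI allI impI)
    fix z A assume z: "z \<in> V" "z \<noteq> r" "good z" "A \<subseteq> branch z \<inter> odds"
    show "H z A \<subseteq> branch z \<inter> odds"
      unfolding H_def
      by (intro iso_odds_image[OF \<psi>'[OF z(1,2)]] rigid_coding_odds[OF S[OF good_rep[OF z(1,2,3)]]]
          I[OF z(1,2,4)])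
  next
    fix z z' A A' f
    assume z: "z \<in> V" "z \<noteq> r" "good z" and z': "z' \<in> V" "z' \<noteq> r" and par: "par z = par z'"
      and A: "A \<subseteq> branch z \<inter> odds" and A': "A' \<subseteq> branch z' \<inter> odds"
      and f: "branch_iso z z' f" and im: "f ` H z A = H z' A'"
    define w where "w = rep z"
    have "z' \<in> twin_class z" using f z' par by (auto simp: twin_class_def children_def)
    then have cl: "twin_class z' = twin_class z" by (rule twin_class_eq)
    then have w': "rep z' = w" by (simp add: w_def rep_def)
    have w: "w \<in> V" "w \<noteq> r" "twin_class w = twin_class z" "good w"
      using rep'[OF z(1,2)] rep''[OF z(1,2)] good_rep[OF z(1-3)] by (simp_all add: w_def)
    have zw: "branch_iso z w (\<psi> z)" "branch_iso w z (\<psi>' z)"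
      using \<psi>[OF z(1,2)] \<psi>'[OF z(1,2)] by (simp_all add: w_def)
    have zw': "branch_iso z' w (\<psi> z')"
      using \<psi>[OF z'] by (simp add: w')
    \<comment> \<open>Going from the representative to \<open>z\<close>, by \<open>f\<close> to
      \<open>z'\<close> and back gives a self-isomorphism of the representative branch, to which its
      rigid coding applies.\<close>
    define k where "k = \<psi> z' \<circ> (f \<circ> \<psi>' z)"
    have k: "branch_iso w w k"
      unfolding k_def by (rule iso_comp[OF iso_comp[OF zw(2) f] zw'])
    have IA: "I z A \<subseteq> branch w \<inter> odds" "I z' A' \<subseteq> branch w \<inter> odds"
      using I[OF z(1,2) A] I[OF z' A'] by (simp_all add: w' w_def[symmetric])
    have "k ` S w (I z A) = \<psi> z' ` f ` H z A"
      by (simp only: k_def H_def w_def image_comp comp_assoc)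
    also have "\<dots> = \<psi> z' ` \<psi>' z' ` S w (I z' A')"
      unfolding im unfolding H_def w' ..
    also have "\<dots> = S w (I z' A')"
      unfolding \<psi>'_def
      by (rule iso_inv_image(2)[OF zw']) (use rigid_coding_odds[OF S[OF w(4)] IA(2)] in simp)
    finally have eq: "I z A = I z' A'" and kid: "\<forall>v\<in>branch w. k v = v"
      using rigid_codingD[OF S[OF w(4)] IA k] by blast+
    have "j w (z, \<psi> z ` A) = j w (z', \<psi> z' ` A')"
      using eq by (simp only: I_def w' w_def)
    moreover have "(z, \<psi> z ` A) \<in> twin_class w \<times> Pow (branch w \<inter> odds)"
      using iso_odds_image[OF zw(1) A] twin_class_self[OF z(1,2)] w(3) by (intro SigmaI PowI) simp_all
    moreover have "(z', \<psi> z' ` A') \<in> twin_class w \<times> Pow (branch w \<inter> odds)"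
      using iso_odds_image[OF zw' A'] \<open>z' \<in> twin_class z\<close> w(3) by (intro SigmaI PowI) simp_all
    ultimately have "(z, \<psi> z ` A) = (z', \<psi> z' ` A')"
      by (rule inj_onD[OF j(1)[OF w(1,2)]])
    then have zz: "z = z'" and AA: "\<psi> z ` A = \<psi> z ` A'" by blast+
    have "A \<subseteq> branch z" "A' \<subseteq> branch z" using A A' zz by blast+
    then have "A = A'"
      using inj_on_image_eq_iff[OF iso_inj[OF zw(1)]] AA by blast
    moreover have "f u = u" if u: "u \<in> branch z" for u
    proof -
      have "\<psi> z u \<in> branch w" by (rule iso_mem[OF zw(1) u])
      then have "k (\<psi> z u) = \<psi> z u" using kid by blast
      moreover have "\<psi>' z (\<psi> z u) = u"
        unfolding \<psi>'_def by (rule iso_inv_apply(1)[OF zw(1) u])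
      ultimately have "\<psi> z (f u) = \<psi> z u" using zz by (simp add: k_def)
      moreover have "f u \<in> branch z" using iso_mem[OF f u] zz by simp
      ultimately show ?thesis using inj_onD[OF iso_inj[OF zw(1)]] u by metis
    qed
    ultimately show "z = z'" "A = A'" "\<forall>v\<in>branch z. f v = v" using zz by blast+
  qed
  then show ?thesis by blast
qed

text \<open>\<open>X\<close> contains with each vertex the whole way up to \<open>x\<close>, so
  nothing below a vertex off \<open>X\<close> can be in \<open>X\<close> again.\<close>

lemma branch_avoids:
  assumes "\<And>v. v \<in> X \<Longrightarrow> v \<noteq> x \<Longrightarrow> par v \<in> X" "z \<in> branch x" "z \<notin> X" "x \<in> V" "x \<in> X"
  shows "branch z \<inter> X = {}"
proof -
  have "v \<notin> X" if "v \<in> branch z" for v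
    using that
  proof (induction rule: branch.induct)
    case (branch_step w)
    have "w \<noteq> x"
      using branch_dep_le[OF branch_trans[OF branch_step.hyps(1) assms(2)] assms(4)]
        dep_par[OF branch_step.hyps(2,3)] by auto
    then show ?case using branch_step.IH assms(1) by blast
  qed (rule assms(3))
  then show ?thesis by blast
qed

text \<open>Gluing: the branches hanging off \<open>X\<close>, with roots in \<open>Z\<close>, are
  disjoint and cover the rest of \<open>branch x\<close>, and an index \<open>A\<close> is split
  into its traces on \<open>X\<close> and on them. Once the colours on \<open>X\<close> fix
  \<open>X\<close> pointwise, a hanging branch could only be exchanged with one at the same parent,
  and a sibling coding rules that out.\<close>

lemma good_by_skeleton:
  assumes x: "x \<in> V" "x \<in> X" and X: "X \<subseteq> branch x"
    and up: "\<And>v. v \<in> X \<Longrightarrow> v \<noteq> x \<Longrightarrow> par v \<in> X"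
    and off: "\<And>z. z \<in> branch x \<Longrightarrow> z \<notin> X \<Longrightarrow> par z \<in> X \<Longrightarrow> good z"
    and inv: "\<And>f. branch_iso x x f \<Longrightarrow> f ` X = X"
    and C: "\<And>A. A \<subseteq> X \<inter> odds \<Longrightarrow> C A \<subseteq> X \<inter> odds"
    and rigid: "\<And>A A' f. A \<subseteq> X \<inter> odds \<Longrightarrow> A' \<subseteq> X \<inter> odds \<Longrightarrow> branch_iso x x f \<Longrightarrow>
       f ` C A = C A' \<Longrightarrow> A = A' \<and> (\<forall>v\<in>X. f v = v)"
  shows "good x"
proof -
  obtain H where H: "sibling_coding H" using ex_sibling_coding by blast
  define Z where "Z = {z \<in> branch x. z \<notin> X \<and> par z \<in> X}"
  have Z: "z \<in> V" "z \<noteq> r" "z \<noteq> x" "good z" "z \<in> branch x" "z \<notin> X" "par z \<in> X" if "z \<in> Z" for z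
    using that off x branch_par[of z x] by (auto simp: Z_def)
  have ZX: "branch z \<inter> X = {}" if "z \<in> Z" for z
    by (rule branch_avoids[OF up _ _ x]) (use Z[OF that] in auto)
  have ZZ: "z = z'" if "z \<in> Z" "z' \<in> Z" "v \<in> branch z" "v \<in> branch z'" for z z' v
  proof (rule ccontr)
    have *: False if "a \<in> Z" "b \<in> Z" "a \<in> branch b" "a \<noteq> b" for a b
      using branch_par[OF that(3,4)] Z[OF that(1)] ZX[OF that(2)] by blast
    assume "z \<noteq> z'"
    then show False using branch_comparable[OF that(3,4)] * that(1,2) by blast
  qed
  have cover: "v \<in> X \<or> (\<exists>z\<in>Z. v \<in> branch z)" if "v \<in> branch x" for v
    using that
  proof (induction rule: branch.induct)
    case (branch_step w)
    show ?case
    proof (cases "par w \<in> X")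
      case True
      have "w \<in> branch x" using branch_step branch.branch_step by blast
      then show ?thesis using True branch_base by (auto simp: Z_def)
    next
      case False
      then show ?thesis using branch_step branch.branch_step by blast
    qed
  qed (use x in blast)
  define S where "S A = C (A \<inter> X) \<union> (\<Union>z\<in>Z. H z (A \<inter> branch z))" for A
  have CA: "C (A \<inter> X) \<subseteq> X \<inter> odds" if "A \<subseteq> branch x \<inter> odds" for A
    by (rule C) (use that in auto)
  have HA: "H z (A \<inter> branch z) \<subseteq> branch z \<inter> odds" if "A \<subseteq> branch x \<inter> odds" "z \<in> Z" for A z
    by (rule sibling_coding_odds[OF H]) (use that Z[OF that(2)] in auto)
  have SX: "S A \<inter> X = C (A \<inter> X)" if "A \<subseteq> branch x \<inter> odds" for A
    using CA[OF that] HA[OF that] ZX unfolding S_def by blast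
  have SZ: "S A \<inter> branch z = H z (A \<inter> branch z)" if A: "A \<subseteq> branch x \<inter> odds" and z: "z \<in> Z" for A z
  proof
    show "H z (A \<inter> branch z) \<subseteq> S A \<inter> branch z"
      using HA[OF A z] z unfolding S_def by blast
    show "S A \<inter> branch z \<subseteq> H z (A \<inter> branch z)"
    proof
      fix v assume v: "v \<in> S A \<inter> branch z"
      then have "v \<notin> C (A \<inter> X)" using CA[OF A] ZX[OF z] by blast
      then obtain z' where "z' \<in> Z" "v \<in> H z' (A \<inter> branch z')" using v unfolding S_def by blast
      moreover from this have "z' = z" using ZZ[of z' z v] HA[OF A] z v by blast
      ultimately show "v \<in> H z (A \<inter> branch z)" by simp
    qed
  qed
  have "rigid_coding x S"
  proof (rule rigid_codingI)
    fix A assume A: "A \<subseteq> branch x \<inter> odds"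
    have "H z (A \<inter> branch z) \<subseteq> branch x \<inter> odds" if "z \<in> Z" for z
      using HA[OF A that] branch_trans Z(5)[OF that] by blast
    then show "S A \<subseteq> branch x \<inter> odds" using CA[OF A] X unfolding S_def by blast
  next
    fix A A' f
    assume A: "A \<subseteq> branch x \<inter> odds" "A' \<subseteq> branch x \<inter> odds" and f: "branch_iso x x f"
      and im: "f ` S A = S A'"
    have SB: "S A \<subseteq> branch x"
      using CA[OF A(1)] HA[OF A(1)] branch_trans Z(5) X unfolding S_def by blast
    have "f ` C (A \<inter> X) = f ` (S A \<inter> X)" by (simp only: SX[OF A(1)])
    also have "\<dots> = f ` S A \<inter> f ` X"
      by (rule inj_on_image_Int[OF iso_inj[OF f] SB X])
    also have "\<dots> = C (A' \<inter> X)" by (simp only: im inv[OF f] SX[OF A(2)])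
    finally have AX: "A \<inter> X = A' \<inter> X" and fX: "\<forall>v\<in>X. f v = v"
      using rigid[of "A \<inter> X" "A' \<inter> X" f] A f by blast+
    have fZ: "A \<inter> branch z = A' \<inter> branch z \<and> (\<forall>v\<in>branch z. f v = v)" if z: "z \<in> Z" for z
    proof -
      have fz: "par (f z) = par z" using iso_par[OF f Z(5)[OF z] Z(3)[OF z]] fX Z(7)[OF z] by simp
      \<comment> \<open>\<open>f\<close> is injective and already fixes \<open>X\<close> pointwise,
        so no vertex off \<open>X\<close> can enter it.\<close>
      have "f z \<notin> X"
      proof
        assume "f z \<in> X"
        then have "f (f z) = f z" using fX by blast
        then have "f z = z"
          using inj_onD[OF iso_inj[OF f]] iso_mem[OF f Z(5)[OF z]] Z(5)[OF z] by blast
        then show False using \<open>f z \<in> X\<close> Z(6)[OF z] by simp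
      qed
      then have z': "f z \<in> Z" using iso_mem[OF f Z(5)[OF z]] fz Z(7)[OF z] by (simp add: Z_def)
      have "f ` H z (A \<inter> branch z) = f ` (S A \<inter> branch z)" by (simp only: SZ[OF A(1) z])
      also have "\<dots> = f ` S A \<inter> f ` branch z"
        by (rule inj_on_image_Int[OF iso_inj[OF f] SB]) (use branch_trans Z(5)[OF z] in blast)
      also have "f ` branch z = branch (f z)"
        using iso_restrict[OF f Z(5)[OF z]] by (simp add: branch_iso_def bij_betw_def)
      also have "f ` S A \<inter> branch (f z) = H (f z) (A' \<inter> branch (f z))"
        by (simp only: im SZ[OF A(2) z'])
      finally have "z = f z \<and> A \<inter> branch z = A' \<inter> branch (f z) \<and> (\<forall>v\<in>branch z. f v = v)"
        using A by (intro sibling_codingD[OF H Z(1,2,4)[OF z] Z(1,2)[OF z'] fz[symmetric] _ _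
              iso_restrict[OF f Z(5)[OF z]]]) auto
      then show ?thesis by simp
    qed
    have "v \<in> A \<longleftrightarrow> v \<in> A'" for v
    proof (cases "v \<in> branch x")
      case True
      then show ?thesis using cover[OF True] AX fZ by blast
    qed (use A in blast)
    moreover have "f v = v" if "v \<in> branch x" for v
      using cover[OF that] fX fZ by blast
    ultimately show "A = A' \<and> (\<forall>v\<in>branch x. f v = v)" by blast
  qed
  then show ?thesis using good_def by blast
qed

text \<open>If all children were good, the one-vertex skeleton with the identity as coding would
  make \<open>x\<close> good, as a self-isomorphism of \<open>branch x\<close> fixes
  \<open>x\<close>.\<close>

lemma bad_child:
  assumes "x \<in> V" "\<not> good x"
  obtains w where "w \<in> children x" "\<not> good w"
proof -
  have "good x" if all: "\<And>w. w \<in> children x \<Longrightarrow> good w"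
  proof (rule good_by_skeleton[of x "{x}" "\<lambda>A. A"])
    show "good z" if "z \<in> branch x" "z \<notin> {x}" "par z \<in> {x}" for z
      using all[of z] branch_par[of z x] that by (auto simp: children_def)
    show "f ` {x} = {x}" if "branch_iso x x f" for f using iso_in[OF that] by simp
    show "A = A' \<and> (\<forall>v\<in>{x}. f v = v)" if "branch_iso x x f" "f ` A = A'" "A \<subseteq> {x} \<inter> odds" for A A' f
    proof -
      have "A = {} \<or> A = {x}" using that(3) by blast
      then show ?thesis using iso_in[OF that(1)] that(2) by auto
    qed
  qed (use assms branch_base in auto)
  then show ?thesis using assms that by blast
qed

end

section \<open>Cores of bad vertices\<close>

definition seg :: "'a set \<Rightarrow> 'a \<Rightarrow> 'a set" where
  "seg X a = underS |X| a"

lemma seg_subset: "seg X a \<subseteq> X"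
  unfolding seg_def underS_def using Field_card_of[of X] by (auto simp: Field_def)

text \<open>\<open>|X|\<close> is a well-order of \<open>X\<close> of least type, so its proper
  segments are smaller in cardinality. This lets all labels below a given one fit into a level of a
  core.\<close>

lemma seg_small: "a \<in> X \<Longrightarrow> |seg X a| <o |X|"
  unfolding seg_def by (rule card_of_underS) (simp_all add: card_of_card_order_on Field_card_of)

lemma seg_strict:
  assumes "a \<in> X" "b \<in> X" "a \<noteq> b"
  shows "seg X a \<subset> seg X b \<or> seg X b \<subset> seg X a"
proof -
  have wo: "Well_order |X|" by (rule card_of_Well_order)
  then have tr: "trans |X|" "antisym |X|" "Total |X|"
    by (simp_all add: well_order_on_def linear_order_on_def partial_order_on_def preorder_on_def)
  have mono: "seg X c \<subset> seg X d" if "(c, d) \<in> |X|" "c \<noteq> d" for c d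
    using underS_incr[OF tr(1,2) that(1)] that unfolding seg_def underS_def by blast
  have "(a, b) \<in> |X| \<or> (b, a) \<in> |X|"
    using tr(3) assms Field_card_of[of X] unfolding total_on_def by blast
  then show ?thesis using mono assms(3) by blast
qed

lemma seg_inj: "a \<in> X \<Longrightarrow> b \<in> X \<Longrightarrow> seg X a = seg X b \<Longrightarrow> a = b"
  using seg_strict[of a X b] by auto

text \<open>Segments of different elements are strictly nested, so finite ones differ in
  size.\<close>

lemma seg_card_inj:
  assumes "a \<in> X" "b \<in> X" "finite (seg X a)" "finite (seg X b)" "card (seg X a) = card (seg X b)"
  shows "a = b"
proof (rule ccontr)
  assume "a \<noteq> b"
  then have "seg X a \<subset> seg X b \<or> seg X b \<subset> seg X a" by (rule seg_strict[OF assms(1,2)])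
  then have "card (seg X a) < card (seg X b) \<or> card (seg X b) < card (seg X a)"
    using psubset_card_mono[OF assms(3)] psubset_card_mono[OF assms(4)] by blast
  then show False using assms(5) by simp
qed

lemma seg_induct [consumes 1, case_names less]:
  assumes "a \<in> X" "\<And>a. a \<in> X \<Longrightarrow> (\<And>b. b \<in> seg X a \<Longrightarrow> P b) \<Longrightarrow> P a"
  shows "P a"
proof -
  have "wf ( |X| - Id)" using card_of_Well_order[of X] by (simp add: well_order_on_def)
  then have "a \<in> X \<longrightarrow> P a"
  proof (induction a rule: wf_induct_rule)
    case (less a)
    have "P b" if "b \<in> seg X a" for b
      using less[of b] that seg_subset[of X a] by (auto simp: seg_def underS_def)
    then show ?case using assms(2) by blast
  qed
  then show ?thesis using assms(1) by blast
qed

section \<open>Cores and their levels\<close>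

context twin_bounded_tree
begin

inductive_set core :: "'a \<Rightarrow> 'a set" for y where
  core_base: "y \<in> core y"
| core_step: "v \<in> core y \<Longrightarrow> w \<in> children v \<Longrightarrow> \<not> good w \<Longrightarrow> w \<in> core y"

lemma core_branch: "v \<in> core y \<Longrightarrow> v \<in> branch y"
  by (induction rule: core.induct) (auto intro: branch_base children_branch)

lemma core_in: "v \<in> core y \<Longrightarrow> y \<in> V \<Longrightarrow> v \<in> V"
  using core_branch branch_in by blast

lemma core_bad: "v \<in> core y \<Longrightarrow> \<not> good y \<Longrightarrow> \<not> good v"
  by (induction rule: core.induct) auto

lemma core_par: "v \<in> core y \<Longrightarrow> v \<noteq> y \<Longrightarrow> par v \<in> core y \<and> v \<in> children (par v)"
  by (erule core.cases) (auto simp: children_def)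

lemma core_trans: "v \<in> core z \<Longrightarrow> z \<in> core y \<Longrightarrow> v \<in> core y"
  by (induction rule: core.induct) (auto intro: core.intros)

text \<open>Goodness is invariant under branch isomorphisms, so bad children go to bad
  children.\<close>

lemma core_iso:
  assumes f: "branch_iso y y' f" and v: "v \<in> core y"
  shows "f v \<in> core y'"
  using v
proof (induction rule: core.induct)
  case core_base
  then show ?case using iso_in[OF f] core.core_base by simp
next
  case (core_step v w)
  have v: "v \<in> branch y" using core_step core_branch by blast
  then have w: "w \<in> branch y" using core_step children_branch by blast
  have "\<not> good (f w)"
    using core_step(3) good_transport[OF _ iso_inv[OF iso_restrict[OF f w]]] by blast
  then show ?case using core.core_step core_step iso_children[OF f v] by blast
qed

lemma core_iso_image:
  assumes f: "branch_iso y y' f"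
  shows "f ` core y = core y'"
proof
  show "f ` core y \<subseteq> core y'" using core_iso[OF f] by blast
  show "core y' \<subseteq> f ` core y"
  proof
    fix w assume w: "w \<in> core y'"
    have "f (inv_into (branch y) f w) = w"
      by (rule iso_inv_apply(2)[OF f core_branch[OF w]])
    moreover have "inv_into (branch y) f w \<in> core y" by (rule core_iso[OF iso_inv[OF f] w])
    ultimately show "w \<in> f ` core y" by force
  qed
qed

definition level :: "'a \<Rightarrow> nat \<Rightarrow> 'a set" where
  "level y d = {v \<in> core y. dep v = dep y + d}"

lemma level_iso: "branch_iso y y' f \<Longrightarrow> v \<in> level y d \<Longrightarrow> f v \<in> level y' d"
  using core_iso[of y y' f v] iso_dep[of y y' f v] core_branch[of v y] by (simp add: level_def)

lemma level_Suc_par: "v \<in> level y (Suc d) \<Longrightarrow> par v \<in> level y d \<and> v \<in> children (par v)"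
proof -
  assume v: "v \<in> level y (Suc d)"
  then have "v \<noteq> y" by (auto simp: level_def)
  then show ?thesis using core_par[of v y] children_dep[of v "par v"] v by (simp add: level_def)
qed

lemma level_Suc_ex:
  assumes "y \<in> V" "\<not> good y" "v \<in> level y d"
  obtains w where "w \<in> level y (Suc d)" "par w = v"
proof -
  have "v \<in> core y" using assms by (simp add: level_def)
  then obtain w where "w \<in> children v" "\<not> good w"
    using bad_child core_in core_bad assms by metis
  then have "w \<in> level y (Suc d)" "par w = v"
    using assms core_step children_dep by (auto simp: level_def children_def)
  then show ?thesis using that by blast
qed

lemma level_nonempty: "y \<in> V \<Longrightarrow> \<not> good y \<Longrightarrow> level y d \<noteq> {}"
proof (induction d)
  case 0
  then show ?case using core_base by (auto simp: level_def)
next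
  case (Suc d)
  then show ?case using level_Suc_ex by blast
qed

text \<open>By \<open>bad_child\<close> each vertex of a level has a child in the next level, so
  \<open>par\<close> covers the former from the latter.\<close>

lemma level_mono: "y \<in> V \<Longrightarrow> \<not> good y \<Longrightarrow> |level y d| \<le>o |level y (d + k)|"
proof (induction k)
  case (Suc k)
  have "level y (d + k) \<subseteq> par ` level y (Suc (d + k))"
    using level_Suc_ex[OF Suc.prems] by (metis imageI subsetI)
  then have "|level y (d + k)| \<le>o |level y (Suc (d + k))|" by (rule surj_imp_ordLeq)
  then show ?case using Suc ordLeq_transitive by fastforce
qed (simp add: card_of_refl ordIso_imp_ordLeq)

lemma core_levels: "y \<in> V \<Longrightarrow> core y = (\<Union>d. level y d)"
  using branch_dep_le[OF core_branch] by (force simp: level_def nat_le_iff_add)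

lemma core_infinite:
  assumes "y \<in> V" "\<not> good y"
  shows "infinite (core y)"
proof
  assume "finite (core y)"
  then have "finite (dep ` core y)" by simp
  then obtain n where n: "\<forall>d\<in>dep ` core y. d \<le> n" using finite_nat_set_iff_bounded_le by blast
  obtain v where "v \<in> level y (Suc n)" using level_nonempty[OF assms] by blast
  then show False using n by (force simp: level_def)
qed

lemma level_trans: "v \<in> level y d \<Longrightarrow> w \<in> level v e \<Longrightarrow> w \<in> level y (d + e)"
  using core_trans by (auto simp: level_def)

text \<open>The reason is that a core is a countable union of levels.\<close>

lemma large_level:
  assumes "y \<in> V" "infinite A" "|A| <o |core y|"
  shows "\<exists>d. |A| \<le>o |level y d|"
proof (rule ccontr)
  assume "\<nexists>d. |A| \<le>o |level y d|"
  then have "\<forall>d\<in>UNIV. |level y d| \<le>o |A|" by (metis card_of_Well_order ordLeq_total)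
  moreover have "|UNIV :: nat set| \<le>o |A|" using assms(2) infinite_iff_card_of_nat by blast
  ultimately have "|\<Union>d\<in>UNIV. level y d| \<le>o |A|"
    by (intro card_of_UNION_ordLeq_infinite[OF assms(2)])
  then show False using assms(3) core_levels[OF assms(1)] not_ordLess_ordLeq by metis
qed

text \<open>\<open>x1\<close> has a least core among all bad vertices. Cores of vertices in
  \<open>core x1\<close> are contained in it and therefore equally large, so a bad child of
  \<open>x1\<close> is minimal as well. One of the two is odd, as the nodes of the later coding have
  to be.\<close>

lemma minimal_core:
  assumes "x0 \<in> V" "\<not> good x0"
  obtains x where "x \<in> V" "\<not> good x" "odd (dep x)" "\<And>y. y \<in> core x \<Longrightarrow> |core x| \<le>o |core y|"
proof -
  let ?R = "{ |core y| | y. y \<in> V \<and> \<not> good y}"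
  have "\<exists>c\<in>?R. \<forall>c'\<in>?R. c \<le>o c'"
    by (rule exists_minim_Card_order) (use assms card_of_Card_order in blast)+
  then obtain x1 where x1: "x1 \<in> V" "\<not> good x1"
    and min: "\<And>y. y \<in> V \<Longrightarrow> \<not> good y \<Longrightarrow> |core x1| \<le>o |core y|" by blast
  obtain w where w: "w \<in> children x1" "\<not> good w" using bad_child[OF x1] .
  have min': "|core u| \<le>o |core y|" if "u \<in> core x1" "y \<in> core u" for u y
  proof -
    have "y \<in> V" "\<not> good y" using that core_trans core_in core_bad x1 by blast+
    moreover have "|core u| \<le>o |core x1|" using core_trans that(1) by (intro card_of_mono1) blast
    ultimately show ?thesis using min ordLeq_transitive by blast
  qed
  show ?thesis
  proof (cases "odd (dep x1)")
    case True
    then show ?thesis using that[of x1] x1 min' core_base by blast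
  next
    case False
    then have "odd (dep w)" using children_dep[OF w(1)] by simp
    moreover have "w \<in> core x1" using core_step[OF core_base w] .
    ultimately show ?thesis using that[of w] w min' core_in[OF _ x1(1)] by blast
  qed
qed

end

section \<open>Coding a minimal core\<close>

text \<open>A hypothetical configuration: \<open>no_minimal_bad\<close> shows these assumptions to
  be contradictory.\<close>

locale minimal_bad = twin_bounded_tree +
  fixes x :: 'a
  assumes x_in: "x \<in> V" and x_bad: "\<not> good x" and x_odd: "odd (dep x)"
    and x_min: "\<And>y. y \<in> core x \<Longrightarrow> |core x| \<le>o |core y|"
begin

abbreviation X :: "'a set" where "X \<equiv> core x"

text \<open>
  \<^term>\<open>X\<close> is cut into blocks. A block consists of the first \<open>len y a\<close> levels below a node
  \<open>y\<close> with label \<open>a\<close>; the vertices of the next level are again nodes. Labels are elements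
  of the well-ordered set \<^term>\<open>X\<close>. Every block has even length, so nodes are odd. On the
  odd vertices of a block, offset 0 shows the flag of the node, offset 2 is free, the
  offsets from 4 on are coloured and the last one is not, so that the block length can be
  read off the colouring.
\<close>

definition half :: "'a \<Rightarrow> 'a \<Rightarrow> nat" where
  "half y a = (SOME k. (finite (seg X a) \<longrightarrow> k = 2 * card (seg X a) + 1) \<and>
     (infinite (seg X a) \<longrightarrow> even k \<and> |seg X a| \<le>o |level y (2 * k + 6)| ))"

text \<open>The summand 6 guarantees offsets 0, 2 and 4 in every block, so that the uncoloured
  offset at its end never falls on the flag or on a free vertex.\<close>

definition len :: "'a \<Rightarrow> 'a \<Rightarrow> nat" where
  "len y a = 2 * half y a + 6"

definition member_emb :: "'a \<Rightarrow> 'a \<Rightarrow> 'a \<Rightarrow> 'a" where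
  "member_emb y a = (SOME g. inj_on g (seg X a) \<and> g ` seg X a \<subseteq> level y (len y a))"

text \<open>These are the nodes to be flagged. A label with finitely many predecessors has none,
  being coded by the block length instead.\<close>

definition members :: "'a \<Rightarrow> 'a \<Rightarrow> 'a set" where
  "members y a = (if finite (seg X a) then {} else member_emb y a ` seg X a)"

text \<open>An unflagged node is its own label. Labels are thus injective on flagged and on
  unflagged nodes separately, and a clash between the two kinds is resolved by the flag.\<close>

definition next_label :: "'a \<Rightarrow> 'a \<Rightarrow> 'a \<Rightarrow> 'a" where
  "next_label y a q = (if q \<in> members y a then inv_into (seg X a) (member_emb y a) q else q)"

text \<open>The components are the node of the current block, its label, its flag and the offset in
  the block. The intended argument is \<open>n = dep v - dep x\<close>. A vertex opens a new block
  when its parent has the last offset of the old one.\<close>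

primrec state :: "nat \<Rightarrow> 'a \<Rightarrow> 'a \<times> 'a \<times> bool \<times> nat" where
  "state 0 v = (x, x, False, 0)"
| "state (Suc n) v = (case state n (par v) of (y, a, b, j) \<Rightarrow>
     if Suc j = len y a then (v, next_label y a v, v \<in> members y a, 0) else (y, a, b, Suc j))"

definition owner :: "'a \<Rightarrow> 'a" where "owner v = fst (state (dep v - dep x) v)"
definition label :: "'a \<Rightarrow> 'a" where "label v = fst (snd (state (dep v - dep x) v))"
definition flag :: "'a \<Rightarrow> bool" where "flag v = fst (snd (snd (state (dep v - dep x) v)))"
definition pos :: "'a \<Rightarrow> nat" where "pos v = snd (snd (snd (state (dep v - dep x) v)))"

abbreviation blen :: "'a \<Rightarrow> nat" where "blen y \<equiv> len y (label y)"

lemma X_in: "v \<in> X \<Longrightarrow> v \<in> V"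
  using core_in x_in by blast

lemma X_bad: "v \<in> X \<Longrightarrow> \<not> good v"
  using core_bad x_bad by blast

lemma x_X: "x \<in> X" by (rule core_base)

lemma core_X: "y \<in> X \<Longrightarrow> v \<in> core y \<Longrightarrow> v \<in> X"
  using core_trans by blast

lemma level_X: "y \<in> X \<Longrightarrow> v \<in> level y d \<Longrightarrow> v \<in> X"
  using core_X by (simp add: level_def)

text \<open>For an infinite segment: it is smaller than \<open>X\<close>, hence than
  \<open>core y\<close> by minimality, and fits into some level \<open>d\<close>. Levels grow, so
  level \<open>4 * d + 6\<close> has room too, which is the even choice
  \<open>k = 2 * d\<close>.\<close>

lemma half:
  assumes y: "y \<in> X" and a: "a \<in> X"
  shows "(finite (seg X a) \<longrightarrow> half y a = 2 * card (seg X a) + 1) \<and>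
     (infinite (seg X a) \<longrightarrow> even (half y a) \<and> |seg X a| \<le>o |level y (len y a)| )"
proof -
  have "\<exists>k. (finite (seg X a) \<longrightarrow> k = 2 * card (seg X a) + 1) \<and>
     (infinite (seg X a) \<longrightarrow> even k \<and> |seg X a| \<le>o |level y (2 * k + 6)| )"
  proof (cases "finite (seg X a)")
    case True
    then show ?thesis by blast
  next
    case False
    have "|seg X a| <o |core y|"
      using ordLess_ordLeq_trans[OF seg_small[OF a] x_min[OF y]] .
    then obtain d where d: "|seg X a| \<le>o |level y d|"
      using large_level[OF X_in[OF y] False] by blast
    have "|level y d| \<le>o |level y (d + (3 * d + 6))|"
      by (rule level_mono[OF X_in[OF y] X_bad[OF y]])
    moreover have "d + (3 * d + 6) = 2 * (2 * d) + 6" by simp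
    ultimately have "|seg X a| \<le>o |level y (2 * (2 * d) + 6)|"
      using d ordLeq_transitive by metis
    moreover have "even (2 * d)" by simp
    ultimately show ?thesis using False by blast
  qed
  then show ?thesis unfolding len_def half_def by (rule someI_ex)
qed

text \<open>The block length thus also reveals which of the two ways of coding the label is in
  force.\<close>

lemma half_parity: "y \<in> X \<Longrightarrow> a \<in> X \<Longrightarrow> odd (half y a) \<longleftrightarrow> finite (seg X a)"
  using half[of y a] by (cases "finite (seg X a)") simp_all

lemma member_emb:
  assumes "y \<in> X" "a \<in> X" "infinite (seg X a)"
  shows "inj_on (member_emb y a) (seg X a)" "member_emb y a ` seg X a \<subseteq> level y (len y a)"
proof -
  have "\<exists>g. inj_on g (seg X a) \<and> g ` seg X a \<subseteq> level y (len y a)"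
    using half[OF assms(1,2)] assms(3) by (simp only: card_of_ordLeq) blast
  then have "inj_on (member_emb y a) (seg X a) \<and> member_emb y a ` seg X a \<subseteq> level y (len y a)"
    unfolding member_emb_def by (rule someI_ex)
  then show "inj_on (member_emb y a) (seg X a)" "member_emb y a ` seg X a \<subseteq> level y (len y a)" by blast+
qed

lemma mem_level: "y \<in> X \<Longrightarrow> a \<in> X \<Longrightarrow> members y a \<subseteq> level y (len y a)"
  using member_emb(2) by (simp add: members_def)

lemma lab_mem:
  assumes "y \<in> X" "a \<in> X" "infinite (seg X a)"
  shows "next_label y a ` members y a = seg X a"
proof -
  have "next_label y a ` members y a = inv_into (seg X a) (member_emb y a) ` member_emb y a ` seg X a"
    using assms by (simp add: next_label_def members_def)
  also have "\<dots> = seg X a" by (rule inv_into_image_cancel[OF member_emb(1)[OF assms]]) simp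
  finally show ?thesis .
qed

lemma lab_X: "y \<in> X \<Longrightarrow> a \<in> X \<Longrightarrow> q \<in> X \<Longrightarrow> next_label y a q \<in> X"
proof -
  assume *: "y \<in> X" "a \<in> X" "q \<in> X"
  show ?thesis
  proof (cases "q \<in> members y a")
    case True
    then have "infinite (seg X a)" by (auto simp: members_def)
    then have "next_label y a q \<in> seg X a" using lab_mem[OF *(1,2)] True by blast
    then show ?thesis using seg_subset[of X a] by blast
  qed (simp add: next_label_def *)
qed

lemma lab_inj:
  assumes "q \<in> members y a \<longleftrightarrow> q' \<in> members y a" "next_label y a q = next_label y a q'"
  shows "q = q'"
proof (cases "q \<in> members y a")
  case True
  then have "inv_into (seg X a) (member_emb y a) q = inv_into (seg X a) (member_emb y a) q'"
    using assms by (simp add: next_label_def)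
  moreover have "q \<in> member_emb y a ` seg X a" "q' \<in> member_emb y a ` seg X a"
    using True assms(1) by (auto simp: members_def split: if_splits)
  ultimately show ?thesis by (rule inv_into_injective)
qed (use assms in \<open>simp add: next_label_def\<close>)

section \<open>The decomposition of the core into blocks\<close>

lemma state_root: "owner x = x" "label x = x" "flag x = False" "pos x = 0"
  by (simp_all add: owner_def label_def flag_def pos_def)

lemma st_step:
  assumes "v \<in> X" "v \<noteq> x"
  shows "state (dep v - dep x) v = (let p = par v in
    if Suc (pos p) = len (owner p) (label p)
    then (v, next_label (owner p) (label p) v, v \<in> members (owner p) (label p), 0)
    else (owner p, label p, flag p, Suc (pos p)))"
proof -
  have "par v \<in> X" "v \<in> children (par v)" using core_par assms by blast+
  then have "dep v = Suc (dep (par v))" "dep x \<le> dep (par v)"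
    using children_dep branch_dep_le[OF core_branch x_in] by blast+
  then have "dep v - dep x = Suc (dep (par v) - dep x)" by simp
  then show ?thesis
    by (simp add: owner_def label_def flag_def pos_def Let_def split: prod.split)
qed

lemma state_step:
  assumes "v \<in> X" "v \<noteq> x" "Suc (pos (par v)) \<noteq> len (owner (par v)) (label (par v))"
  shows "owner v = owner (par v)" "label v = label (par v)" "flag v = flag (par v)" "pos v = Suc (pos (par v))"
  using st_step[OF assms(1,2)] assms(3)
  by (simp_all only: owner_def[of v] label_def[of v] flag_def[of v] pos_def[of v] Let_def if_False fst_conv snd_conv)

lemma state_new:
  assumes "v \<in> X" "v \<noteq> x" "Suc (pos (par v)) = len (owner (par v)) (label (par v))"
  shows "owner v = v" "label v = next_label (owner (par v)) (label (par v)) v"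
    "flag v \<longleftrightarrow> v \<in> members (owner (par v)) (label (par v))" "pos v = 0"
proof -
  have e: "state (dep v - dep x) v = (v, next_label (owner (par v)) (label (par v)) v,
      v \<in> members (owner (par v)) (label (par v)), 0)"
    using st_step[OF assms(1,2)] by (simp only: Let_def if_P[OF assms(3)])
  show "owner v = v" "label v = next_label (owner (par v)) (label (par v)) v"
    "flag v \<longleftrightarrow> v \<in> members (owner (par v)) (label (par v))" "pos v = 0"
    by (simp_all only: owner_def[of v] label_def[of v] flag_def[of v] pos_def[of v] e fst_conv snd_conv)
qed

definition nodes :: "'a set" where "nodes = {v \<in> X. owner v = v}"

text \<open>Each edge downwards either continues the block or opens a new one at distance
  \<open>blen\<close> from the old node. This distance is even, which keeps nodes odd.\<close>

lemma state_inv: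
  assumes "v \<in> X"
  shows "owner v \<in> nodes \<and> label v \<in> X \<and> pos v < blen (owner v) \<and> v \<in> level (owner v) (pos v) \<and>
    label (owner v) = label v \<and> flag (owner v) = flag v \<and> odd (dep (owner v)) \<and> pos (owner v) = 0"
  using assms
proof (induction "dep v" arbitrary: v rule: less_induct)
  case less
  show ?case
  proof (cases "v = x")
    case True
    then show ?thesis
      using x_odd core_base by (simp add: nodes_def state_root len_def level_def)
  next
    case False
    define p where "p = par v"
    have p: "p \<in> X" "v \<in> children p" using core_par[OF less(2) False] p_def by blast+
    then have dv: "dep v = Suc (dep p)" using children_dep by blast
    then have IH: "owner p \<in> nodes" "label p \<in> X" "pos p < blen (owner p)" "p \<in> level (owner p) (pos p)"
      "label (owner p) = label p" "flag (owner p) = flag p" "odd (dep (owner p))" "pos (owner p) = 0"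
      using less(1)[of p] p(1) by auto
    have "v \<in> core (owner p)"
      using core_step[OF _ p(2) X_bad[OF less(2)]] IH(4) by (simp add: level_def)
    then have lv: "v \<in> level (owner p) (Suc (pos p))" using IH(4) dv by (simp add: level_def)
    show ?thesis
    proof (cases "Suc (pos p) = len (owner p) (label p)")
      case True
      note new = state_new[OF less(2) False, folded p_def, OF True]
      have "odd (dep v)"
        using lv True IH(7) by (simp add: level_def len_def)
      moreover have "label v \<in> X"
        unfolding new(2) using lab_X[OF _ IH(2) less(2)] IH(1) by (simp add: nodes_def)
      ultimately show ?thesis
        using new(1,4) less(2) core_base by (simp add: nodes_def level_def len_def)
    next
      case neq: False
      note old = state_step[OF less(2) False, folded p_def, OF neq]
      have "Suc (pos p) < blen (owner p)" using IH(3,5) neq by simp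
      then show ?thesis using old IH lv by simp
    qed
  qed
qed

lemma node_pos: "v \<in> nodes \<Longrightarrow> pos v = 0"
  using state_inv[of v] by (auto simp: nodes_def)

lemma nodes_X: "y \<in> nodes \<Longrightarrow> y \<in> X" by (simp add: nodes_def)

lemma node_odd: "y \<in> nodes \<Longrightarrow> odd (dep y)"
  using state_inv[of y] by (auto simp: nodes_def)

lemma node_lb: "y \<in> nodes \<Longrightarrow> label y \<in> X"
  using state_inv[of y] by (auto simp: nodes_def)

text \<open>\<open>state_inv\<close> leads from a vertex up to its owner; here the block is
  traversed downwards from the node, level by level.\<close>

lemma block_state:
  assumes "y \<in> nodes" "v \<in> level y d" "d < blen y"
  shows "owner v = y \<and> label v = label y \<and> pos v = d"
  using assms(2,3)
proof (induction d arbitrary: v)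
  case 0
  then have "v = y"
    using branch_dep[OF core_branch[of v y] X_in[OF nodes_X[OF assms(1)]]] by (auto simp: level_def)
  then show ?case using assms(1) node_pos by (auto simp: nodes_def)
next
  case (Suc d)
  have p: "par v \<in> level y d" "v \<in> children (par v)" using level_Suc_par[OF Suc(2)] by blast+
  have IH: "owner (par v) = y" "label (par v) = label y" "pos (par v) = d" using Suc p by simp_all
  have v: "v \<in> X" using level_X nodes_X assms(1) Suc(2) by blast
  have "v \<noteq> x"
    using branch_dep_le[OF core_branch[OF nodes_X[OF assms(1)]] x_in] Suc(2) by (auto simp: level_def)
  then show ?case using state_step[OF v] IH Suc(3) by simp
qed

lemma next_node_state:
  assumes "y \<in> nodes" "v \<in> level y (blen y)"
  shows "v \<in> nodes" "label v = next_label y (label y) v" "flag v \<longleftrightarrow> v \<in> members y (label y)"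
proof -
  have l: "blen y = Suc (blen y - 1)" by (simp add: len_def)
  then have "v \<in> level y (Suc (blen y - 1))" using assms(2) by simp
  then have "par v \<in> level y (blen y - 1)" by (rule level_Suc_par[THEN conjunct1])
  then have p: "owner (par v) = y \<and> label (par v) = label y \<and> pos (par v) = blen y - 1"
    by (rule block_state[OF assms(1)]) (simp add: len_def)
  have v: "v \<in> X" using level_X nodes_X assms by blast
  have vx: "v \<noteq> x"
    using branch_dep_le[OF core_branch[OF nodes_X[OF assms(1)]] x_in] assms(2)
    by (auto simp: level_def len_def)
  have "Suc (pos (par v)) = len (owner (par v)) (label (par v))" using p l by simp
  note new = state_new[OF v vx this]
  show "v \<in> nodes" "label v = next_label y (label y) v" "flag v \<longleftrightarrow> v \<in> members y (label y)"
    using new v p by (simp_all add: nodes_def)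
qed

lemma node_parent:
  assumes "v \<in> nodes" "v \<noteq> x"
  obtains y where "y \<in> nodes" "v \<in> level y (blen y)"
proof -
  define p where "p = par v"
  have v: "v \<in> X" using assms nodes_X by blast
  have p: "p \<in> X" "v \<in> children p" using core_par[OF v assms(2)] p_def by blast+
  have inv: "owner p \<in> nodes" "p \<in> level (owner p) (pos p)" "label (owner p) = label p"
    using state_inv[OF p(1)] by blast+
  have "Suc (pos p) = len (owner p) (label p)"
  proof (rule ccontr)
    assume "Suc (pos p) \<noteq> len (owner p) (label p)"
    then have "pos v = Suc (pos p)" using state_step[OF v assms(2)] p_def by blast
    then show False using node_pos assms(1) by simp
  qed
  moreover have "v \<in> core (owner p)"
    using core_step[OF _ p(2) X_bad[OF v]] inv(2) by (simp add: level_def)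
  ultimately have "v \<in> level (owner p) (blen (owner p))"
    using inv(2,3) children_dep[OF p(2)] by (simp add: level_def)
  then show ?thesis using that inv(1) by blast
qed

text \<open>Descending within the core from \<open>v\<close> past the end of its block reaches a
  node.\<close>

lemma node_below:
  assumes "v \<in> X"
  obtains w where "w \<in> core v" "w \<in> nodes"
proof -
  have inv: "owner v \<in> nodes" "v \<in> level (owner v) (pos v)" "pos v < blen (owner v)"
    using state_inv[OF assms] by blast+
  obtain w where w: "w \<in> level v (blen (owner v) - pos v)"
    using level_nonempty[OF X_in[OF assms] X_bad[OF assms]] by blast
  have "w \<in> level (owner v) (blen (owner v))" using level_trans[OF inv(2) w] inv(3) by simp
  then show ?thesis using that next_node_state(1)[OF inv(1)] w by (auto simp: level_def)
qed

section \<open>Free vertices and the colouring\<close>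

definition free :: "'a set" where "free = {v \<in> X. pos v = 2}"

lemma free_below:
  assumes "v \<in> X"
  obtains w where "w \<in> free" "w \<in> branch v"
proof -
  obtain u where u: "u \<in> core v" "u \<in> nodes" using node_below[OF assms] .
  have uX: "u \<in> X" using u(2) nodes_X by blast
  obtain w where w: "w \<in> level u 2" using level_nonempty[OF X_in[OF uX] X_bad[OF uX]] by blast
  have "pos w = 2" using block_state[OF u(2) w] by (simp add: len_def)
  moreover have "w \<in> X" using level_X[OF uX w] .
  moreover have "w \<in> branch v"
    using w u(1) core_branch core_trans by (simp add: level_def) blast
  ultimately show ?thesis using that by (simp add: free_def)
qed

lemma finite_ancestors: "w \<in> V \<Longrightarrow> finite {v \<in> V. w \<in> branch v}"
proof (induction "dep w" arbitrary: w rule: less_induct)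
  case less
  have *: "{v \<in> V. w \<in> branch v} \<subseteq> insert w {v \<in> V. par w \<in> branch v \<and> w \<noteq> r}"
    using branch_par by blast
  show ?case
  proof (cases "w = r")
    case True
    then have "{v \<in> V. w \<in> branch v} \<subseteq> {w}" using * by blast
    then show ?thesis using finite_subset by blast
  next
    case False
    then have "finite {v \<in> V. par w \<in> branch v}"
      using less par_in[of w] dep_par[of w] by simp
    moreover have "{v \<in> V. w \<in> branch v} \<subseteq> insert w {v \<in> V. par w \<in> branch v}" using * by blast
    ultimately show ?thesis by (meson finite_insert finite_subset)
  qed
qed

text \<open>Every vertex of \<open>X\<close> is an ancestor of a free one, and ancestor sets are
  finite. So \<open>free\<close> is infinite, and a union of finite sets indexed by it is no larger
  than it.\<close>

lemma ex_free_injection: "\<exists>slot. inj_on slot X \<and> slot ` X \<subseteq> free"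
proof -
  have cover: "X \<subseteq> (\<Union>w\<in>free. {v \<in> V. w \<in> branch v})"
  proof
    fix v assume v: "v \<in> X"
    obtain w where "w \<in> free" "w \<in> branch v" using free_below[OF v] .
    then show "v \<in> (\<Union>w\<in>free. {v \<in> V. w \<in> branch v})" using X_in[OF v] by blast
  qed
  have fin: "finite {v \<in> V. w \<in> branch v}" if "w \<in> free" for w
    using that finite_ancestors X_in by (simp add: free_def)
  have "infinite X" using core_infinite[OF x_in x_bad] .
  have inf: "infinite free"
  proof
    assume "finite free"
    then have "finite (\<Union>w\<in>free. {v \<in> V. w \<in> branch v})" by (rule finite_UN_I) (rule fin)
    then have "finite X" by (rule finite_subset[OF cover])
    with \<open>infinite X\<close> show False by contradiction
  qed
  have "|{v \<in> V. w \<in> branch v}| \<le>o |free|" if "w \<in> free" for w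
  proof (rule ordLess_imp_ordLeq, rule finite_ordLess_infinite[OF card_of_Well_order card_of_Well_order])
    show "finite (Field |{v \<in> V. w \<in> branch v}| )" using fin[OF that] by (simp only: Field_card_of)
    show "infinite (Field |free| )" using inf by (simp only: Field_card_of not_False_eq_True)
  qed
  then have "|\<Union>w\<in>free. {v \<in> V. w \<in> branch v}| \<le>o |free|"
    by (intro card_of_UNION_ordLeq_infinite[OF inf ordIso_imp_ordLeq[OF card_of_refl]] ballI)
  then have "|X| \<le>o |free|" using card_of_mono1[OF cover] ordLeq_transitive by blast
  then show ?thesis by (simp only: card_of_ordLeq)
qed

definition slot :: "'a \<Rightarrow> 'a" where "slot = (SOME slot. inj_on slot X \<and> slot ` X \<subseteq> free)"

lemma slot: "inj_on slot X" "slot ` X \<subseteq> free"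
  using someI_ex[OF ex_free_injection] unfolding slot_def by blast+

text \<open>The first part is the same for all \<open>A\<close> and codes the labels; the index is
  stored through \<open>slot\<close> on free vertices alone.\<close>

definition paint :: "'a set \<Rightarrow> 'a set" where
  "paint A = {v \<in> X \<inter> odds. (pos v = 0 \<and> flag v) \<or> (4 \<le> pos v \<and> pos v + 2 < blen (owner v))} \<union> slot ` A"

lemma free_odd: "free \<subseteq> X \<inter> odds"
proof
  fix v assume v: "v \<in> free"
  then have "v \<in> X" "pos v = 2" by (simp_all add: free_def)
  then have "v \<in> level (owner v) 2" "odd (dep (owner v))" using state_inv[of v] by auto
  then show "v \<in> X \<inter> odds" using \<open>v \<in> X\<close> by (simp add: level_def odds_def)
qed

lemma paint_odds: "A \<subseteq> X \<inter> odds \<Longrightarrow> paint A \<subseteq> X \<inter> odds"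
  using slot(2) free_odd unfolding paint_def by blast

lemma paint_iff:
  assumes "A \<subseteq> X" "v \<in> X" "odd (dep v)" "pos v \<noteq> 2"
  shows "v \<in> paint A \<longleftrightarrow> (pos v = 0 \<and> flag v) \<or> (4 \<le> pos v \<and> pos v + 2 < blen (owner v))"
proof -
  have "v \<notin> slot ` A" using slot(2) assms(1,4) by (auto simp: free_def)
  then show ?thesis using assms by (simp add: paint_def odds_def)
qed

lemma paint_free:
  assumes "A \<subseteq> X"
  shows "paint A \<inter> free = slot ` A"
proof -
  have "slot ` A \<subseteq> free" using slot(2) assms by blast
  moreover have "v \<in> slot ` A" if "v \<in> paint A" "v \<in> free" for v
    using that unfolding paint_def by (auto simp: free_def)
  ultimately show ?thesis unfolding paint_def by blast
qed

section \<open>Reading the labels off the colouring\<close>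

definition matches :: "'a set \<Rightarrow> 'a set \<Rightarrow> 'a \<Rightarrow> 'a \<Rightarrow> ('a \<Rightarrow> 'a) \<Rightarrow> bool" where
  "matches A A' y y' f \<longleftrightarrow> A \<subseteq> X \<and> A' \<subseteq> X \<and> branch_iso y y' f \<and>
     (\<forall>v\<in>core y. v \<in> paint A \<longleftrightarrow> f v \<in> paint A')"

lemma matches_inv:
  assumes "matches A A' y y' f"
  shows "matches A' A y' y (inv_into (branch y) f)"
proof -
  let ?g = "inv_into (branch y) f"
  have f: "branch_iso y y' f" using assms matches_def by blast
  have "w \<in> paint A' \<longleftrightarrow> ?g w \<in> paint A" if "w \<in> core y'" for w
  proof -
    have "?g w \<in> core y" by (rule core_iso[OF iso_inv[OF f] that])
    moreover have "f (?g w) = w" by (rule iso_inv_apply(2)[OF f core_branch[OF that]])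
    ultimately show ?thesis using assms unfolding matches_def by metis
  qed
  then show ?thesis using assms iso_inv[OF f] unfolding matches_def by blast
qed

text \<open>Colours are compared on cores only, so a match passes to the nodes further down; the
  inductions below rest on this.\<close>

lemma matches_restrict:
  assumes "matches A A' y y' f" "z \<in> core y"
  shows "matches A A' z (f z) f"
  using assms iso_restrict[of y y' f z] core_branch core_trans unfolding matches_def by blast

text \<open>Were the block of \<open>y'\<close> longer, the last odd vertices in the block of
  \<open>y\<close>, which are uncoloured, would go to vertices of the same offset that are not last
  and hence coloured.\<close>

lemma matches_len_le:
  assumes "y \<in> nodes" "y' \<in> nodes" "matches A A' y y' f"
  shows "blen y' \<le> blen y"
proof (rule ccontr)
  assume "\<not> blen y' \<le> blen y"
  then have less: "blen y < blen y'" by simp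
  have A: "A \<subseteq> X" "A' \<subseteq> X" and f: "branch_iso y y' f" using assms(3) matches_def by blast+
  \<comment> \<open>The last even offset; it is at least 4, so neither flag nor free vertex
    interferes.\<close>
  define d where "d = blen y - 2"
  have d: "4 \<le> d" "d < blen y" "\<not> d + 2 < blen y" "even d" "d + 2 < blen y'"
    using less by (simp_all add: d_def len_def)
  have yX: "y \<in> X" "y' \<in> X" using assms nodes_X by blast+
  obtain v where v: "v \<in> level y d" using level_nonempty[OF X_in[OF yX(1)] X_bad[OF yX(1)]] by blast
  have fv: "f v \<in> level y' d" by (rule level_iso[OF f v])
  have s: "owner v = y" "pos v = d" using block_state[OF assms(1) v d(2)] by blast+
  have s': "owner (f v) = y'" "pos (f v) = d" using block_state[OF assms(2) fv] d(5) by simp_all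
  have odd: "odd (dep v)" "odd (dep (f v))"
    using v fv d(4) node_odd assms(1,2) by (simp_all add: level_def)
  have "v \<notin> paint A"
    using paint_iff[OF A(1) level_X[OF yX(1) v] odd(1)] s d(1,3) by simp
  moreover have "f v \<in> paint A'"
    using paint_iff[OF A(2) level_X[OF yX(2) fv] odd(2)] s' d(1,5) by simp
  moreover have "v \<in> core y" using v by (simp add: level_def)
  ultimately show False using assms(3) unfolding matches_def by blast
qed

lemma matches_len:
  assumes "y \<in> nodes" "y' \<in> nodes" "matches A A' y y' f"
  shows "blen y' = blen y"
  using matches_len_le[OF assms] matches_len_le[OF assms(2,1) matches_inv[OF assms(3)]] by simp

lemma matches_flag:
  assumes "y \<in> nodes" "f y \<in> nodes" "matches A A' y (f y) f"
  shows "flag (f y) \<longleftrightarrow> flag y"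
proof -
  have A: "A \<subseteq> X" "A' \<subseteq> X" using assms(3) matches_def by blast+
  have "y \<in> paint A \<longleftrightarrow> flag y"
    using paint_iff[OF A(1) nodes_X[OF assms(1)] node_odd[OF assms(1)]] node_pos[OF assms(1)] by simp
  moreover have "f y \<in> paint A' \<longleftrightarrow> flag (f y)"
    using paint_iff[OF A(2) nodes_X[OF assms(2)] node_odd[OF assms(2)]] node_pos[OF assms(2)] by simp
  moreover have "y \<in> paint A \<longleftrightarrow> f y \<in> paint A'"
    using assms(3) core_base unfolding matches_def by blast
  ultimately show ?thesis by blast
qed

text \<open>
  A label with finitely many predecessors is read off the block length; any other label is
  determined, in the manner of von Neumann ordinals, by the labels of the flagged nodes
  that end the block, and these are smaller.
\<close>

lemma matches_label:
  assumes "y \<in> nodes" "y' \<in> nodes" "matches A A' y y' f"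
  shows "label y' = label y"
proof -
  \<comment> \<open>The induction is on the label of \<open>y\<close>, with \<open>y\<close>,
    \<open>y'\<close> and \<open>f\<close> general, because the hypothesis is applied to the nodes
    that end the two blocks.\<close>
  have "\<forall>y y' f. y \<in> nodes \<longrightarrow> y' \<in> nodes \<longrightarrow> matches A A' y y' f \<longrightarrow> label y = a \<longrightarrow> label y' = a"
    if "a \<in> X" for a
    using that
  proof (induction a rule: seg_induct)
    case (less a)
    show ?case
    proof (intro allI impI)
      fix y y' f
      assume y: "y \<in> nodes" and y': "y' \<in> nodes" and m: "matches A A' y y' f" and a: "label y = a"
      define a' where "a' = label y'"
      have aX: "a \<in> X" "a' \<in> X" using node_lb y' less(1) a'_def by blast+
      have yX: "y \<in> X" "y' \<in> X" using nodes_X y y' by blast+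
      have f: "branch_iso y y' f" using m matches_def by blast
      have len: "len y' a' = len y a" using matches_len[OF y y' m] by (simp add: a a'_def)
      then have half_eq: "half y' a' = half y a" by (simp add: len_def)
      then have fin: "finite (seg X a') \<longleftrightarrow> finite (seg X a)"
        using half_parity[OF yX(1) aX(1)] half_parity[OF yX(2) aX(2)] half_eq by simp
      show "label y' = a"
      proof (cases "finite (seg X a)")
        case True
        then have "2 * card (seg X a') + 1 = 2 * card (seg X a) + 1"
          using half_eq half[OF yX(1) aX(1)] half[OF yX(2) aX(2)] fin by simp
        then show ?thesis using seg_card_inj[OF aX(2,1)] True fin by (simp add: a'_def)
      next
        case False
        have next1: "q \<in> nodes" "label q = next_label y a q" "flag q \<longleftrightarrow> q \<in> members y a"
          if "q \<in> level y (len y a)" for q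
          using next_node_state[OF y, unfolded a] that by blast+
        have next2: "q \<in> nodes" "label q = next_label y' a' q" "flag q \<longleftrightarrow> q \<in> members y' a'"
          if "q \<in> level y' (len y' a')" for q
          using next_node_state[OF y', folded a'_def] that by blast+
        have step: "f q \<in> level y' (len y' a')" "matches A A' q (f q) f"
          "f q \<in> members y' a' \<longleftrightarrow> q \<in> members y a"
          if q: "q \<in> level y (len y a)" for q
        proof -
          show fq: "f q \<in> level y' (len y' a')" using level_iso[OF f q] len by simp
          show mq: "matches A A' q (f q) f"
            using matches_restrict[OF m] q by (simp add: level_def)
          show "f q \<in> members y' a' \<longleftrightarrow> q \<in> members y a"
            using matches_flag[OF next1(1)[OF q] next2(1)[OF fq] mq] next1(3)[OF q] next2(3)[OF fq]
            by simp
        qed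
        \<comment> \<open>The flagged node \<open>q\<close> carries a predecessor of
          \<open>a\<close>, and this alone admits the induction hypothesis; \<open>a'\<close> has
          not yet been compared with \<open>a\<close>.\<close>
        have IH: "next_label y' a' (f q) = next_label y a q" if "q \<in> members y a" for q
        proof -
          have q: "q \<in> level y (len y a)" using mem_level[OF yX(1) aX(1)] that by blast
          have "label q \<in> seg X a"
            using lab_mem[OF yX(1) aX(1) False] that next1(2)[OF q] by blast
          then have "label (f q) = label q"
            using less(2) next1(1)[OF q] next2(1)[OF step(1)[OF q]] step(2)[OF q] by blast
          then show ?thesis using next1(2)[OF q] next2(2)[OF step(1)[OF q]] by simp
        qed
        have "members y' a' = f ` members y a"
        proof
          show "f ` members y a \<subseteq> members y' a'"
            using step(3) mem_level[OF yX(1) aX(1)] by blast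
          show "members y' a' \<subseteq> f ` members y a"
          proof
            fix w assume w: "w \<in> members y' a'"
            then have wl: "w \<in> level y' (len y a)" using mem_level[OF yX(2) aX(2)] len by auto
            define q where "q = inv_into (branch y) f w"
            have q: "q \<in> level y (len y a)" unfolding q_def by (rule level_iso[OF iso_inv[OF f] wl])
            have "f q = w"
              unfolding q_def
              by (rule iso_inv_apply(2)[OF f core_branch]) (use wl in \<open>simp add: level_def\<close>)
            then show "w \<in> f ` members y a" using step(3)[OF q] w by blast
          qed
        qed
        then have "next_label y' a' ` members y' a' = next_label y a ` members y a" using IH by (simp add: image_image)
        then have "seg X a' = seg X a"
          using lab_mem[OF yX(1) aX(1) False] lab_mem[OF yX(2) aX(2)] fin False by simp
        then show ?thesis using seg_inj[OF aX(2,1)] by (simp add: a'_def)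
      qed
    qed
  qed
  then show ?thesis using assms node_lb[OF assms(1)] by blast
qed

text \<open>The node \<open>z\<close> whose block leads to \<open>y\<close> is fixed by induction.
  Then \<open>y\<close> and \<open>f y\<close> both end the block of \<open>z\<close> and agree in
  label and flag, so \<open>lab_inj\<close> identifies them.\<close>

lemma matches_fixes_nodes:
  assumes m: "matches A A' x x f" and y: "y \<in> nodes"
  shows "f y = y"
  using y
proof (induction "dep y" arbitrary: y rule: less_induct)
  case less
  show ?case
  proof (cases "y = x")
    case True
    then show ?thesis using m iso_in unfolding matches_def by blast
  next
    case False
    obtain z where z: "z \<in> nodes" "y \<in> level z (blen z)" using node_parent[OF less(2) False] .
    have "dep z < dep y" using z(2) by (simp add: level_def len_def)
    then have fz: "f z = z" using less(1) z(1) by blast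
    have mz: "matches A A' z z f" using matches_restrict[OF m nodes_X[OF z(1)]] fz by simp
    then have fy: "f y \<in> level z (blen z)" using level_iso z(2) unfolding matches_def by blast
    have my: "matches A A' y (f y) f" using matches_restrict[OF m nodes_X[OF less(2)]] .
    have ny: "f y \<in> nodes" using next_node_state(1)[OF z(1) fy] .
    have "next_label z (label z) (f y) = next_label z (label z) y"
      using matches_label[OF less(2) ny my] next_node_state(2)[OF z(1) fy]
        next_node_state(2)[OF z(1,2)] by simp
    moreover have "f y \<in> members z (label z) \<longleftrightarrow> y \<in> members z (label z)"
      using matches_flag[OF less(2) ny my] next_node_state(3)[OF z(1) fy]
        next_node_state(3)[OF z(1,2)] by simp
    ultimately show ?thesis by (rule lab_inj[rotated])
  qed
qed

text \<open>Being fixed climbs from a vertex to its parent, as \<open>f\<close> commutes with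
  \<open>par\<close>.\<close>

lemma iso_fixes_ancestor:
  assumes f: "branch_iso x x f" and "v \<in> branch x" "w \<in> branch v" "f w = w"
  shows "f v = v"
  using assms(3,4)
proof (induction rule: branch.induct)
  case (branch_step w)
  have "par w \<in> branch x" "w \<in> branch x"
    using branch_step(1-3) assms(2) branch_trans branch.branch_step by blast+
  moreover from this have "w \<noteq> x"
    using branch_dep_le[of "par w" x] dep_par[OF branch_step(2,3)] x_in by auto
  ultimately have "f (par w) = par w" using iso_par[OF f] branch_step.prems by simp
  then show ?case by (rule branch_step.IH)
qed

text \<open>Every vertex of \<open>X\<close> has a node below it and is fixed along with it. The two
  colourings then agree on \<open>X\<close>, and their traces on \<open>free\<close> give back
  \<open>A = A'\<close>.\<close>

lemma matches_rigid:
  assumes m: "matches A A' x x f"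
  shows "A = A' \<and> (\<forall>v\<in>X. f v = v)"
proof -
  have A: "A \<subseteq> X" "A' \<subseteq> X" and f: "branch_iso x x f" using m matches_def by blast+
  have fixed: "f v = v" if v: "v \<in> X" for v
  proof -
    obtain w where w: "w \<in> core v" "w \<in> nodes" using node_below[OF v] .
    show ?thesis
      by (rule iso_fixes_ancestor[OF f core_branch[OF v] core_branch[OF w(1)]
            matches_fixes_nodes[OF m w(2)]])
  qed
  have "v \<in> paint A \<longleftrightarrow> v \<in> paint A'" if "v \<in> X" for v
    using m that fixed[OF that] unfolding matches_def by auto
  then have "paint A \<inter> free = paint A' \<inter> free" by (auto simp: free_def)
  then have "slot ` A = slot ` A'" using paint_free A by metis
  then have "A = A'" using inj_on_image_eq_iff[OF slot(1) A] by blast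
  then show ?thesis using fixed by blast
qed

text \<open>A child that leaves the core is good, so \<open>X\<close> coloured by
  \<open>paint\<close> is a skeleton for \<open>x\<close>.\<close>

lemma no_minimal_bad: False
proof -
  have "good x"
  proof (rule good_by_skeleton[of x X paint])
    show "good z" if "z \<in> branch x" "z \<notin> X" "par z \<in> X" for z
    proof -
      have "z \<noteq> x" using that(2) x_X by blast
      then have "z \<in> children (par z)" using branch_par that(1) by (simp add: children_def)
      then show ?thesis using core_step that by blast
    qed
    show "A = A' \<and> (\<forall>v\<in>X. f v = v)"
      if A: "A \<subseteq> X \<inter> odds" "A' \<subseteq> X \<inter> odds" and f: "branch_iso x x f"
        and im: "f ` paint A = paint A'" for A A' f
    proof (rule matches_rigid)
      have "v \<in> paint A \<longleftrightarrow> f v \<in> paint A'" if v: "v \<in> X" for v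
      proof -
        have "paint A \<subseteq> branch x" using paint_odds[OF A(1)] core_branch by blast
        then have "f v \<in> f ` paint A \<longleftrightarrow> v \<in> paint A"
          using inj_on_image_mem_iff[OF iso_inj[OF f] core_branch[OF v]] by blast
        then show ?thesis using im by simp
      qed
      then show "matches A A' x x f" using A f unfolding matches_def by blast
    qed
  qed (use x_in x_X core_branch core_par core_iso_image paint_odds in blast)+
  then show False using x_bad by blast
qed

end

theorem (in twin_bounded_tree) all_good:
  assumes "x \<in> V"
  shows "good x"
proof (rule ccontr)
  assume "\<not> good x"
  then obtain y where y: "y \<in> V" "\<not> good y" "odd (dep y)" "\<And>z. z \<in> core y \<Longrightarrow> |core y| \<le>o |core z|"
    using minimal_core[OF assms] by metis
  interpret minimal_bad V r par dep y
    using y by unfold_locales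
  show False by (rule no_minimal_bad)
qed

section \<open>Rooting a tree; branches of twins\<close>

lemma card_of_Pow_mono:
  assumes "|A| \<le>o |B|"
  shows "|Pow A| \<le>o |Pow B|"
proof -
  obtain f where f: "inj_on f A" "f ` A \<subseteq> B" using assms by (auto simp: card_of_ordLeq[symmetric])
  have "inj_on ((`) f) (Pow A)" using f(1) by (rule inj_on_image_Pow)
  moreover have "(`) f ` Pow A \<subseteq> Pow B" using f(2) by blast
  ultimately show ?thesis using card_of_ordLeq by blast
qed

lemma ctwo_cexp_Pow: "ctwo ^c |A| =o |Pow A|"
proof -
  have "ctwo ^c |A| = |Func A (UNIV :: bool set)|" by (simp add: cexp_def ctwo_def Field_card_of)
  then show ?thesis using card_of_Pow_Func ordIso_symmetric by metis
qed

text \<open>\<open>dep\<close> is the distance from \<open>r\<close>. An edge inside a level, or a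
  second neighbour one level up, would close a cycle.\<close>

lemma tree_rooting:
  assumes tree: "tree V E" and r: "r \<in> V"
  obtains par dep where "rooted_tree V r par dep"
    "\<And>u v. (u, v) \<in> E \<longleftrightarrow> u \<in> V \<and> v \<in> V \<and> (v \<noteq> r \<and> u = par v \<or> u \<noteq> r \<and> v = par u)"
proof -
  have EV: "E \<subseteq> V \<times> V" and sym: "\<And>u v. (u, v) \<in> E \<Longrightarrow> (v, u) \<in> E" and irr: "\<And>u. (u, u) \<notin> E"
    and conn: "\<And>v. v \<in> V \<Longrightarrow> (r, v) \<in> E\<^sup>*" and acyclic: "\<And>vs. \<not> graph_cycle E vs"
    using tree r
    by (auto simp: tree_def simple_graph_def connected_graph_def irrefl_def dest: symD)
  define dep where "dep v = (LEAST n. (r, v) \<in> E ^^ n)" for v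
  have walk: "(r, v) \<in> E ^^ dep v" if v: "v \<in> V" for v
  proof -
    obtain n where "(r, v) \<in> E ^^ n" using conn[OF v] rtrancl_power by blast
    then show ?thesis unfolding dep_def by (rule LeastI)
  qed
  have dep_le: "dep v \<le> n" if "(r, v) \<in> E ^^ n" for v n
    unfolding dep_def using that by (rule Least_le)
  have dep_r: "dep r = 0" using dep_le[of r 0] by simp
  have dep0: "v = r" if "v \<in> V" "dep v = 0" for v using walk[OF that(1)] that(2) by simp
  have dep_edge: "dep v \<le> Suc (dep u)" if "(u, v) \<in> E" for u v
  proof -
    have "(r, u) \<in> E ^^ dep u" using walk that EV by blast
    then have "(r, v) \<in> E ^^ Suc (dep u)" using that by (rule relpow_Suc_I)
    then show ?thesis by (rule dep_le)
  qed
  have ex_par: "\<exists>u. (u, v) \<in> E \<and> dep v = Suc (dep u)" if v: "v \<in> V" "v \<noteq> r" for v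
  proof -
    obtain n where n: "dep v = Suc n" using dep0[OF v(1)] v(2) not0_implies_Suc by blast
    then have "(r, v) \<in> E ^^ Suc n" using walk[OF v(1)] by simp
    then obtain u where u: "(r, u) \<in> E ^^ n" "(u, v) \<in> E" by (rule relpow_Suc_E)
    have "dep u \<le> n" by (rule dep_le[OF u(1)])
    then have "dep v = Suc (dep u)" using dep_edge[OF u(2)] n by simp
    then show ?thesis using u(2) by blast
  qed
  define par where "par v = (SOME u. (u, v) \<in> E \<and> dep v = Suc (dep u))" for v
  have par: "(par v, v) \<in> E" "dep v = Suc (dep (par v))" "par v \<in> V" if v: "v \<in> V" "v \<noteq> r" for v
    using someI_ex[OF ex_par[OF v]] EV unfolding par_def by blast+

  \<comment> \<open>Climb from both ends until the parents coincide. The depth bound ensures that a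
    vertex one level deeper is new to the path; the length bound makes the closed path a
    cycle.\<close>
  have path: "\<exists>vs. distinct vs \<and> successively (\<lambda>u v. (u, v) \<in> E) vs \<and> 3 \<le> length vs \<and>
      hd vs = u \<and> last vs = u' \<and> (\<forall>w\<in>set vs. dep w \<le> n)"
    if "u \<in> V" "u' \<in> V" "u \<noteq> u'" "dep u = n" "dep u' = n" for u u' n
    using that
  proof (induction n arbitrary: u u')
    case 0
    then show ?case using dep0 by metis
  next
    case (Suc n)
    then have "u \<noteq> r" "u' \<noteq> r" using dep_r by auto
    then have p: "(par u, u) \<in> E" "dep (par u) = n" "par u \<in> V"
      and p': "(par u', u') \<in> E" "dep (par u') = n" "par u' \<in> V"
      using par[of u] par[of u'] Suc.prems by simp_all
    show ?case
    proof (cases "par u = par u'")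
      case True
      have "(par u, u') \<in> E" using p'(1) by (simp only: True)
      moreover have "par u \<noteq> u" "par u \<noteq> u'" using p(2) Suc.prems(4,5) by auto
      ultimately show ?thesis
        using sym[OF p(1)] p(2) Suc.prems(3-5) by (intro exI[of _ "[u, par u, u']"]) simp
    next
      case False
      then obtain vs where vs: "distinct vs" "successively (\<lambda>u v. (u, v) \<in> E) vs" "3 \<le> length vs"
        "hd vs = par u" "last vs = par u'" "\<forall>w\<in>set vs. dep w \<le> n"
        using Suc.IH[OF p(3) p'(3) False p(2) p'(2)] by blast
      have "vs \<noteq> []" using vs(3) by auto
      moreover have "u \<notin> set vs" "u' \<notin> set vs" using vs(6) Suc.prems by auto
      ultimately show ?thesis
        using vs p' sym[OF p(1)] Suc.prems
        by (intro exI[of _ "u # vs @ [u']"])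
          (auto simp: successively_Cons successively_append_iff)
    qed
  qed

  have level_edge: "dep u \<noteq> dep v" if e: "(u, v) \<in> E" for u v
  proof
    assume d: "dep u = dep v"
    have "u \<in> V" "v \<in> V" "u \<noteq> v" using e EV irr by auto
    then obtain vs where "distinct vs" "successively (\<lambda>u v. (u, v) \<in> E) vs" "3 \<le> length vs"
      "hd vs = u" "last vs = v"
      using path[of u v "dep v"] d by blast
    then have "graph_cycle E vs" using sym[OF e] by (simp add: graph_cycle_def)
    then show False using acyclic by blast
  qed
  have par_unique: "u = par v" if e: "(u, v) \<in> E" and d: "dep v = Suc (dep u)" for u v
  proof (rule ccontr)
    assume ne: "u \<noteq> par v"
    have v: "v \<in> V" "v \<noteq> r" "u \<in> V" using e d dep_r EV by auto
    note p = par[OF v(1,2)]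
    then obtain vs where vs: "distinct vs" "successively (\<lambda>u v. (u, v) \<in> E) vs" "3 \<le> length vs"
      "hd vs = u" "last vs = par v" "\<forall>w\<in>set vs. dep w \<le> dep u"
      using path[OF v(3) p(3) ne refl] d by auto
    have "vs \<noteq> []" "v \<notin> set vs" using vs(3,6) d by auto
    then have "graph_cycle E (vs @ [v])"
      using vs p(1) sym[OF e] by (auto simp: graph_cycle_def successively_append_iff)
    then show False using acyclic by blast
  qed
  have "rooted_tree V r par dep"
    by unfold_locales (use r dep_r par in auto)
  moreover have "(u, v) \<in> E \<longleftrightarrow> u \<in> V \<and> v \<in> V \<and> (v \<noteq> r \<and> u = par v \<or> u \<noteq> r \<and> v = par u)" for u v
  proof
    assume e: "(u, v) \<in> E"
    then have "dep v = Suc (dep u) \<or> dep u = Suc (dep v)"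
      using dep_edge[OF e] dep_edge[OF sym[OF e]] level_edge[OF e] by linarith
    then show "u \<in> V \<and> v \<in> V \<and> (v \<noteq> r \<and> u = par v \<or> u \<noteq> r \<and> v = par u)"
      using par_unique[OF e] par_unique[OF sym[OF e]] dep_r EV e by auto
  next
    assume "u \<in> V \<and> v \<in> V \<and> (v \<noteq> r \<and> u = par v \<or> u \<noteq> r \<and> v = par u)"
    then show "(u, v) \<in> E" using par(1) sym by blast
  qed
  ultimately show ?thesis by (rule that)
qed

section \<open>From motion and degrees to the bound on twins\<close>

locale motion_tree = rooted_tree V r par dep for V :: "'a set" and r par dep +
  fixes E :: "'a rel" and m :: "'b rel"
  assumes edge_iff:
      "\<And>u v. (u, v) \<in> E \<longleftrightarrow> u \<in> V \<and> v \<in> V \<and> (v \<noteq> r \<and> u = par v \<or> u \<noteq> r \<and> v = par u)"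
    and m_inf: "Cinfinite m"
    and degree: "\<And>v. v \<in> V \<Longrightarrow> |neighbours E v| \<le>o ctwo ^c m"
    and motion: "\<And>\<phi>. automorphism V E \<phi> \<Longrightarrow> moved V \<phi> \<noteq> {} \<Longrightarrow> m \<le>o |moved V \<phi>|"
begin

lemma m_infinite:
  assumes "m \<le>o |A|"
  shows "infinite A"
  using cinfinite_mono[OF assms] m_inf by (simp add: cinfinite_def Field_card_of)

lemma automorphismI:
  assumes bij: "bij_betw \<phi> V V" and root: "\<phi> r = r"
    and par: "\<And>v. v \<in> V \<Longrightarrow> v \<noteq> r \<Longrightarrow> \<phi> (par v) = par (\<phi> v)"
  shows "automorphism V E \<phi>"
proof -
  have inj: "\<phi> u = \<phi> v \<longleftrightarrow> u = v" if "u \<in> V" "v \<in> V" for u v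
    using bij that by (auto simp: bij_betw_def inj_on_def)
  have in_V: "\<phi> v \<in> V" if "v \<in> V" for v using bij that by (rule bij_betwE[rule_format])
  have up: "\<phi> v \<noteq> r \<and> \<phi> u = par (\<phi> v) \<longleftrightarrow> v \<noteq> r \<and> u = par v" if "u \<in> V" "v \<in> V" for u v
  proof (cases "v = r")
    case False
    then have "\<phi> v \<noteq> r" using inj[OF that(2) root_in] root by simp
    moreover have "\<phi> u = par (\<phi> v) \<longleftrightarrow> u = par v"
      using par[OF that(2) False, symmetric] inj[OF that(1) par_in[OF that(2) False]] by simp
    ultimately show ?thesis using False by blast
  qed (simp add: root)
  show ?thesis unfolding automorphism_def using bij up in_V by (auto simp: edge_iff)
qed

text \<open>Exchanging the two branches is a non-identity automorphism that moves vertices of these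
  branches only. So their union has at least \<open>m\<close> vertices, and they are equally
  large.\<close>

lemma twin_branch_large:
  assumes z: "z \<in> children p" and z': "z' \<in> children p" and ne: "z \<noteq> z'" and f: "branch_iso z z' f"
  shows "infinite (branch z) \<and> m \<le>o |branch z|"
proof -
  define g where "g = inv_into (branch z) f"
  have g: "branch_iso z' z g" unfolding g_def by (rule iso_inv[OF f])
  have gf: "g (f v) = v" if "v \<in> branch z" for v
    unfolding g_def by (rule iso_inv_apply(1)[OF f that])
  have fg: "f (g v) = v" if "v \<in> branch z'" for v
    unfolding g_def by (rule iso_inv_apply(2)[OF f that])
  define \<phi> where "\<phi> v = (if v \<in> branch z then f v else if v \<in> branch z' then g v else v)" for v
  have disj: "branch z \<inter> branch z' = {}" by (rule sibling_branch_disjoint[OF z z' ne])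
  have zV: "z \<in> V" "z \<noteq> r" "par z = p" "z' \<in> V" "z' \<noteq> r" "par z' = p"
    using z z' by (simp_all add: children_def)
  have fz: "f z = z'" "g z' = z" using iso_in[OF f] iso_in[OF g] by blast+
  have fm: "f v \<in> branch z'" if "v \<in> branch z" for v by (rule iso_mem[OF f that])
  have gm: "g v \<in> branch z" if "v \<in> branch z'" for v by (rule iso_mem[OF g that])
  have \<phi>V: "\<phi> v \<in> V" if "v \<in> V" for v
    using that fm gm branch_in zV by (auto simp: \<phi>_def)
  have \<phi>\<phi>: "\<phi> (\<phi> v) = v" for v
    using fm gm gf fg disj by (auto simp: \<phi>_def)
  have "automorphism V E \<phi>"
  proof (rule automorphismI)
    show "bij_betw \<phi> V V" by (rule bij_betw_byWitness[of _ \<phi>]) (use \<phi>V \<phi>\<phi> in auto)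
    have "r \<notin> branch z" "r \<notin> branch z'"
      using branch_dep_le[of r z] branch_dep_le[of r z'] zV dep_root dep_par by fastforce+
    then show "\<phi> r = r" by (simp add: \<phi>_def)
    fix v assume v: "v \<in> V" "v \<noteq> r"
    have p: "p \<notin> branch z" "p \<notin> branch z'"
      using branch_dep_le[of p z] branch_dep_le[of p z'] children_dep[OF z] children_dep[OF z'] zV by auto
    consider "v = z" | "v = z'" | "v \<in> branch z" "v \<noteq> z" | "v \<in> branch z'" "v \<noteq> z'"
      | "v \<notin> branch z" "v \<notin> branch z'" by blast
    then show "\<phi> (par v) = par (\<phi> v)"
    proof cases
      case 1
      then show ?thesis using p zV fz branch_base[of z] by (simp add: \<phi>_def)
    next
      case 2
      moreover have "z' \<notin> branch z" using disj branch_base by blast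
      ultimately show ?thesis using p zV fz branch_base[of z'] by (simp add: \<phi>_def)
    next
      case 3
      then show ?thesis using iso_par[OF f] branch_par by (simp add: \<phi>_def)
    next
      case 4
      moreover from this have "par v \<in> branch z'" using branch_par by blast
      moreover from calculation have "v \<notin> branch z" "par v \<notin> branch z" using disj by blast+
      ultimately show ?thesis using iso_par[OF g] by (simp add: \<phi>_def)
    next
      case 5
      then have "par v \<notin> branch z" "par v \<notin> branch z'" using v branch_step by blast+
      then show ?thesis using 5 by (simp add: \<phi>_def)
    qed
  qed
  moreover have "z \<in> moved V \<phi>" using zV ne fz branch_base by (simp add: moved_def \<phi>_def)
  ultimately have m: "m \<le>o |moved V \<phi>|" using motion by blast
  have "moved V \<phi> \<subseteq> branch z \<union> branch z'" by (auto simp: moved_def \<phi>_def)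
  then have m2: "m \<le>o |branch z \<union> branch z'|" using m card_of_mono1 ordLeq_transitive by blast
  then have "infinite (branch z \<union> branch z')" by (rule m_infinite)
  moreover have le: "|branch z'| \<le>o |branch z|"
    by (rule surj_imp_ordLeq[of _ f]) (use f in \<open>simp add: branch_iso_def bij_betw_def\<close>)
  ultimately have inf: "infinite (branch z)" using card_of_ordLeq_finite by blast
  have "|branch z \<union> branch z'| \<le>o |branch z|"
    by (rule card_of_Un_ordLeq_infinite_Field[OF _ ordIso_imp_ordLeq[OF card_of_refl] le])
      (simp_all add: Field_card_of inf card_of_card_order_on)
  then show ?thesis using inf m2 ordLeq_transitive by blast
qed

lemma branch_leaf: "children z = {} \<Longrightarrow> branch z = {z}"
proof -
  assume z: "children z = {}"
  have "v = z" if "v \<in> branch z" for v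
    using that by (induction rule: branch.induct) (use z in \<open>auto simp: children_def\<close>)
  then show ?thesis using branch_base by blast
qed

text \<open>Two leaves at the same parent would be twins with one-vertex branches, against
  \<open>twin_branch_large\<close>; so there is at most one.\<close>

lemma finite_leaf_children: "finite {w \<in> children u. children w = {}}"
proof -
  have "z = z'" if "z \<in> children u" "z' \<in> children u" "children z = {}" "children z' = {}" for z z'
  proof (rule ccontr)
    assume ne: "z \<noteq> z'"
    have "branch_iso z z' (\<lambda>_. z')"
      using that branch_leaf children_dep by (auto simp: branch_iso_def children_def bij_betw_def)
    then have "infinite (branch z)" using twin_branch_large[OF that(1,2) ne] by blast
    then show False using branch_leaf[OF that(3)] by simp
  qed
  then have "\<exists>z. {w \<in> children u. children w = {}} \<subseteq> {z}" by blast
  then show ?thesis using finite_subset by blast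
qed

text \<open>An even vertex other than \<open>x\<close> is the parent of an odd vertex or a leaf
  below one. Hence finite sets \<open>K u\<close>, over the odd \<open>u\<close>, cover the
  branch.\<close>

lemma odd_part_large:
  assumes x: "x \<in> V" and inf: "infinite (branch x)"
  shows "infinite (branch x \<inter> odds) \<and> |branch x| \<le>o |branch x \<inter> odds|"
proof -
  let ?D = "branch x \<inter> odds"
  \<comment> \<open>Having \<open>x\<close> in every \<open>K u\<close> covers it as soon as some
    odd vertex exists.\<close>
  define K where "K u = {x, u, par u} \<union> {w \<in> children u. children w = {}}" for u
  have finK: "finite (K u)" for u using finite_leaf_children by (simp add: K_def)
  have cover: "v \<in> insert x (\<Union>u\<in>?D. K u)" if v: "v \<in> branch x" for v
  proof (cases "odd (dep v) \<or> v = x")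
    case True
    then show ?thesis using v by (auto simp: K_def odds_def)
  next
    case False
    show ?thesis
    proof (cases "children v = {}")
      case True
      have "v \<in> V" "v \<noteq> r" "par v \<in> branch x" using branch_par[OF v] False by blast+
      moreover from this have "par v \<in> odds" using dep_par[of v] False by (simp add: odds_def)
      ultimately show ?thesis using True by (auto simp: K_def children_def)
    next
      case nonleaf: False
      then obtain w where w: "w \<in> children v" by blast
      have "w \<in> ?D" using children_branch[OF w v] children_dep[OF w] False by (simp add: odds_def)
      moreover have "v \<in> K w" using w by (simp add: K_def children_def)
      ultimately show ?thesis by blast
    qed
  qed
  have D: "infinite ?D"
  proof
    assume "finite ?D"
    then have "finite (insert x (\<Union>u\<in>?D. K u))" using finK by simp
    then have "finite (branch x)" using cover by (meson finite_subset subsetI)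
    then show False using inf by contradiction
  qed
  then obtain u where "u \<in> ?D" by (metis finite.emptyI ex_in_conv)
  then have "x \<in> (\<Union>u\<in>?D. K u)" by (auto simp: K_def)
  then have sub: "branch x \<subseteq> (\<Union>u\<in>?D. K u)" using cover by blast
  have "|K u| \<le>o |?D|" for u
  proof (rule ordLess_imp_ordLeq, rule finite_ordLess_infinite[OF card_of_Well_order card_of_Well_order])
    show "finite (Field |K u| )" using finK by (simp only: Field_card_of)
    show "infinite (Field |?D| )" using D by (simp only: Field_card_of not_False_eq_True)
  qed
  then have "|\<Union>u\<in>?D. K u| \<le>o |?D|"
    by (intro card_of_UNION_ordLeq_infinite[OF D ordIso_imp_ordLeq[OF card_of_refl]] ballI)
  then show ?thesis using D card_of_mono1[OF sub] ordLeq_transitive by blast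
qed

text \<open>A branch with a twin has at least \<open>m\<close> odd vertices, so the degree bound
  \<open>2^m\<close> is at most the number of sets of these.\<close>

sublocale twin_bounded_tree
proof unfold_locales
  fix p z z' f
  assume z: "z \<in> children p" and z': "z' \<in> children p" and ne: "z \<noteq> z'" and f: "branch_iso z z' f"
  let ?D = "branch z \<inter> odds"
  have zV: "z \<in> V" "z \<noteq> r" "par z = p" using z by (simp_all add: children_def)
  have large: "infinite (branch z)" "m \<le>o |branch z|"
    using twin_branch_large[OF z z' ne f] by blast+
  have D: "infinite ?D" "|branch z| \<le>o |?D|" using odd_part_large[OF zV(1) large(1)] by blast+
  have pV: "p \<in> V" using par_in[OF zV(1,2)] zV(3) by simp
  have "children p \<subseteq> neighbours E p" using pV by (auto simp: children_def neighbours_def edge_iff)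
  then have "|children p| \<le>o ctwo ^c m" using card_of_mono1 degree[OF pV] ordLeq_transitive by blast
  moreover have "ctwo ^c m \<le>o ctwo ^c |?D|"
    using cexp_mono2_Cnotzero[OF ordLeq_transitive[OF large(2) D(2)] Card_order_ctwo
        Cinfinite_Cnotzero[OF m_inf]] .
  ultimately show "infinite ?D \<and> |children p| \<le>o |Pow ?D|"
    using D(1) ordLeq_transitive ordLeq_ordIso_trans[OF _ ctwo_cexp_Pow] by blast
qed

end

section \<open>Passing from rooted to arbitrary automorphisms\<close>

context motion_tree
begin

text \<open>Edges join the two parity classes, so an automorphism preserves or swaps them, and the
  image of the root decides which.\<close>

lemma automorphism_parity:
  assumes \<phi>: "automorphism V E \<phi>" and v: "v \<in> V"
  shows "even (dep (\<phi> v)) \<longleftrightarrow> even (dep v + dep (\<phi> r))"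
proof -
  have step: "even (dep u) \<longleftrightarrow> odd (dep w)" if "(u, w) \<in> E" for u w
    using that dep_par by (auto simp: edge_iff)
  have "v \<in> branch r" by (rule branch_root[OF v])
  then show ?thesis
  proof (induction rule: branch.induct)
    case branch_base
    then show ?case by (simp add: dep_root)
  next
    case (branch_step w)
    have e: "(par w, w) \<in> E" using branch_step par_in by (auto simp: edge_iff)
    then have "(\<phi> (par w), \<phi> w) \<in> E"
      using \<phi> branch_step par_in by (auto simp: automorphism_def)
    then show ?case using step[OF e] step branch_step.IH by auto
  qed
qed

text \<open>By induction on depth: otherwise \<open>\<phi> v\<close> would be the parent of
  \<open>\<phi> (par v)\<close>, which is \<open>\<phi> (par (par v))\<close>, and injectivity would
  make \<open>v\<close> its own grandparent.\<close>

lemma automorphism_iso: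
  assumes \<phi>: "automorphism V E \<phi>" and root: "\<phi> r = r"
  shows "branch_iso r r \<phi>"
proof -
  have bij: "bij_betw \<phi> V V" using \<phi> by (simp add: automorphism_def)
  then have inj: "u = v" if "\<phi> u = \<phi> v" "u \<in> V" "v \<in> V" for u v
    using that by (auto simp: bij_betw_def inj_on_def)
  have "\<phi> (par v) = par (\<phi> v)" if "v \<in> V" "v \<noteq> r" for v
    using that
  proof (induction "dep v" arbitrary: v rule: less_induct)
    case less
    have p: "par v \<in> V" "dep (par v) < dep v" using par_in dep_par less(2,3) by simp_all
    have "(par v, v) \<in> E" using less(2,3) p(1) by (simp add: edge_iff)
    then have "(\<phi> (par v), \<phi> v) \<in> E" using \<phi> less(2) p(1) by (auto simp: automorphism_def)
    then consider "\<phi> (par v) = par (\<phi> v)" | "\<phi> (par v) \<noteq> r" "\<phi> v = par (\<phi> (par v))"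
      by (auto simp: edge_iff)
    then show ?case
    proof cases
      case 2
      then have pr: "par v \<noteq> r" using root by auto
      then have "\<phi> v = \<phi> (par (par v))" using less(1)[OF p(2,1)] 2 by simp
      then have "v = par (par v)" using inj less(2) par_in[OF p(1) pr] by blast
      then show ?thesis using p(2) dep_par[OF p(1) pr] by simp
    qed
  qed
  then show ?thesis using bij root root_in by (simp add: branch_iso_def branch_root_eq)
qed

text \<open>
  All coloured vertices but the root are odd. Hence an automorphism moving the root would
  have to swap the two parity classes, and then at most one odd vertex could be coloured.
\<close>

lemma ex_asymmetrizing_family:
  assumes V: "infinite V"
  obtains K c where "|Pow V| \<le>o |K :: 'a set set|" "\<And>A. A \<in> K \<Longrightarrow> c A \<subseteq> V"
    "\<And>A A' \<phi>. A \<in> K \<Longrightarrow> A' \<in> K \<Longrightarrow> automorphism V E \<phi> \<Longrightarrow> \<phi> ` c A = c A' \<Longrightarrow>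
       A = A' \<and> (\<forall>v\<in>V. \<phi> v = v)"
proof -
  define D where "D = V \<inter> odds"
  have D: "infinite D" "|V| \<le>o |D|"
    using odd_part_large[OF root_in] V by (simp_all add: D_def branch_root_eq)
  obtain S where S: "rigid_coding r S" using all_good[OF root_in] good_def by blast
  have SD: "S A \<subseteq> D" if "A \<subseteq> D" for A
    using rigid_coding_odds[OF S] that by (simp add: D_def branch_root_eq)
  have Srigid: "A = A' \<and> (\<forall>v\<in>V. f v = v)"
    if "A \<subseteq> D" "A' \<subseteq> D" "branch_iso r r f" "f ` S A = S A'" for A A' f
    using rigid_codingD[OF S _ _ that(3,4)] that(1,2) by (simp add: D_def branch_root_eq)
  \<comment> \<open>Indices with at most one coloured vertex are discarded. \<open>S\<close> is
    injective, so there are at most \<open>|D| + 1\<close> of them, and \<open>2^|D|\<close> indices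
    remain.\<close>
  define J where "J = {A \<in> Pow D. \<exists>u. S A \<subseteq> {u}}"
  define K where "K = Pow D - J"
  define c where "c A = insert r (S A)" for A

  have "inj_on S (Pow D)"
    by (rule inj_onI) (use Srigid[OF _ _ iso_id[OF root_in]] in auto)
  then have "inj_on S J" by (rule inj_on_subset) (auto simp: J_def)
  moreover have "S ` J \<subseteq> (\<lambda>u. {u}) ` D \<union> {{}}"
  proof
    fix B assume "B \<in> S ` J"
    then obtain u where "B \<subseteq> D" "B \<subseteq> {u}" using SD unfolding J_def by blast
    then show "B \<in> (\<lambda>u. {u}) ` D \<union> {{}}" by (cases "B = {}") auto
  qed
  ultimately have "|J| \<le>o |(\<lambda>u. {u}) ` D \<union> {{}}|" using card_of_ordLeq by blast
  moreover have inf: "infinite (Pow D)" using D(1) finite_Pow_iff by blast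
  have "|(\<lambda>u. {u}) ` D \<union> {{}}| <o |Pow D|"
  proof (rule card_of_Un_ordLess_infinite[OF inf])
    show "|(\<lambda>u. {u}) ` D| <o |Pow D|"
      by (rule ordLeq_ordLess_trans[OF card_of_image card_of_Pow])
    show "|{{}}| <o |Pow D|"
      by (rule finite_ordLess_infinite[OF card_of_Well_order card_of_Well_order])
        (simp_all only: Field_card_of inf not_False_eq_True finite.emptyI finite.insertI)
  qed
  ultimately have Jsmall: "|J| <o |Pow D|" by (rule ordLeq_ordLess_trans)
  have "\<not> |K| <o |Pow D|"
  proof
    assume "|K| <o |Pow D|"
    then have "|K \<union> J| <o |Pow D|" by (rule card_of_Un_ordLess_infinite[OF inf _ Jsmall])
    moreover have "K \<union> J = Pow D" by (auto simp: K_def J_def)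
    ultimately show False using ordLess_irreflexive by metis
  qed
  then have "|Pow D| \<le>o |K|" using not_ordLess_iff_ordLeq card_of_Well_order by blast
  then have "|Pow V| \<le>o |K|" using card_of_Pow_mono[OF D(2)] ordLeq_transitive by blast
  moreover have "c A \<subseteq> V" if "A \<in> K" for A
    using SD[of A] that root_in by (auto simp: c_def K_def D_def)
  moreover have "A = A' \<and> (\<forall>v\<in>V. \<phi> v = v)"
    if A: "A \<in> K" and A': "A' \<in> K" and \<phi>: "automorphism V E \<phi>" and im: "\<phi> ` c A = c A'" for A A' \<phi>
  proof -
    have AD: "A \<subseteq> D" "A' \<subseteq> D" using A A' by (auto simp: K_def)
    have inj: "inj_on \<phi> V" using \<phi> by (simp add: automorphism_def bij_betw_def)
    have par: "even (dep (\<phi> v)) \<longleftrightarrow> even (dep v + dep (\<phi> r))" if "v \<in> V" for v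
      by (rule automorphism_parity[OF \<phi> that])
    have oddS: "odd (dep v)" "v \<in> V" if "v \<in> S B" "B \<subseteq> D" for v B
      using SD[OF that(2)] that(1) by (auto simp: D_def odds_def)
    have even_root: "w = r" if "w \<in> c A'" "even (dep w)" for w
      using that oddS(1) AD(2) by (auto simp: c_def)
    have root: "\<phi> r = r"
    proof (cases "even (dep (\<phi> r))")
      case True
      moreover have "\<phi> r \<in> c A'" using im by (auto simp: c_def)
      ultimately show ?thesis using even_root by blast
    next
      case False
      have "\<phi> v = r" if v: "v \<in> S A" for v
      proof (rule even_root)
        show "\<phi> v \<in> c A'" using im v by (auto simp: c_def)
        show "even (dep (\<phi> v))" using par[OF oddS(2)[OF v AD(1)]] oddS(1)[OF v AD(1)] False by simp
      qed
      then have "u = v" if "u \<in> S A" "v \<in> S A" for u v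
        using that inj_onD[OF inj] oddS(2)[OF _ AD(1)] by metis
      then have "\<exists>u. S A \<subseteq> {u}" by blast
      then have "A \<in> J" using AD(1) by (simp add: J_def)
      then show ?thesis using A by (simp add: K_def)
    qed
    have rS: "r \<notin> S B" if "B \<subseteq> D" for B using oddS(1)[OF _ that] dep_root by fastforce
    have "\<phi> ` S A = \<phi> ` (c A - {r})" using rS[OF AD(1)] by (simp add: c_def)
    also have "\<dots> = \<phi> ` c A - \<phi> ` {r}"
      by (rule inj_on_image_set_diff[OF inj]) (use SD[OF AD(1)] root_in in \<open>auto simp: c_def D_def\<close>)
    also have "\<dots> = S A'" unfolding im using rS[OF AD(2)] by (simp add: root c_def)
    finally show ?thesis by (rule Srigid[OF AD automorphism_iso[OF \<phi> root]])
  qed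
  ultimately show ?thesis by (rule that)
qed

text \<open>The map \<open>c\<close> sends different members of \<open>K\<close> to inequivalent
  sets, which gives the lower bound; the upper bound is the number of subsets of
  \<open>V\<close>.\<close>

lemma asymmetrizing_count:
  assumes V: "infinite V"
  shows "asymmetrizable V E \<and> |asym_sets V E // asym_equiv V E| =o ctwo ^c |V|"
proof -
  let ?Q = "asym_sets V E // asym_equiv V E"
  obtain K c where K: "|Pow V| \<le>o |K :: 'a set set|" and cV: "\<And>A. A \<in> K \<Longrightarrow> c A \<subseteq> V"
    and rigid: "\<And>A A' \<phi>. A \<in> K \<Longrightarrow> A' \<in> K \<Longrightarrow> automorphism V E \<phi> \<Longrightarrow> \<phi> ` c A = c A' \<Longrightarrow>
       A = A' \<and> (\<forall>v\<in>V. \<phi> v = v)"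
    by (rule ex_asymmetrizing_family[OF V]) blast
  have asym: "c A \<in> asym_sets V E" if "A \<in> K" for A
    using cV[OF that] rigid[OF that that] by (simp add: asym_sets_def asymmetrizing_def)
  have "inj_on (\<lambda>A. asym_equiv V E `` {c A}) K"
  proof (rule inj_onI)
    fix A A' assume A: "A \<in> K" "A' \<in> K" and eq: "asym_equiv V E `` {c A} = asym_equiv V E `` {c A'}"
    have "(c A, c A') \<in> asym_equiv V E"
      by (rule eq_equiv_class[OF eq equiv_asym_equiv asym[OF A(2)]])
    then obtain \<phi> where "automorphism V E \<phi>" "\<phi> ` c A = c A'" by (auto simp: asym_equiv_def)
    then show "A = A'" using rigid[OF A] by blast
  qed
  moreover have "(\<lambda>A. asym_equiv V E `` {c A}) ` K \<subseteq> ?Q" using asym quotientI by fastforce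
  ultimately have "|K| \<le>o |?Q|" using card_of_ordLeq by blast
  then have lower: "|Pow V| \<le>o |?Q|" using K ordLeq_transitive by blast
  have "?Q = (\<lambda>S. asym_equiv V E `` {S}) ` asym_sets V E" by (auto simp: quotient_def)
  then have "|?Q| \<le>o |asym_sets V E|" using card_of_image by metis
  moreover have "|asym_sets V E| \<le>o |Pow V|"
    by (rule card_of_mono1) (auto simp: asym_sets_def asymmetrizing_def)
  ultimately have "|?Q| \<le>o |Pow V|" using ordLeq_transitive by blast
  then have "|?Q| =o |Pow V|" using lower ordIso_iff_ordLeq by blast
  then have "|?Q| =o ctwo ^c |V|"
    using ordIso_transitive ordIso_symmetric[OF ctwo_cexp_Pow] by blast
  moreover have "K \<noteq> {}"
  proof
    assume "K = {}"
    then show False using card_of_empty3[of "Pow V"] K by auto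
  qed
  ultimately show ?thesis using asym by (auto simp: asymmetrizable_def asym_sets_def)
qed

end

theorem theorem1p1:
  fixes m :: "'b rel" and V :: "'a set" and E :: "'a rel"
  assumes "Cinfinite m"
    and "tree V E"
    and "\<forall>v\<in>V. |neighbours E v| \<le>o ctwo ^c m"
    and "has_motion V E m"
  shows "asymmetrizable V E \<and>
         |asym_sets V E // asym_equiv V E| =o ctwo ^c |V|"
proof -
  obtain r where r: "r \<in> V" using assms(2) by (auto simp: tree_def connected_graph_def)
  obtain par dep where rooted: "rooted_tree V r par dep"
    and edges: "\<And>u v. (u, v) \<in> E \<longleftrightarrow> u \<in> V \<and> v \<in> V \<and> (v \<noteq> r \<and> u = par v \<or> u \<noteq> r \<and> v = par u)"
    by (rule tree_rooting[OF assms(2) r]) blast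
  interpret rooted_tree V r par dep by (rule rooted)
  interpret motion_tree V r par dep E m
    using edges assms by unfold_locales (auto simp: has_motion_def)
  \<comment> \<open>The automorphism attaining the motion moves \<open>m\<close> vertices, which
    makes \<open>V\<close> infinite.\<close>
  obtain \<phi> where "|moved V \<phi>| =o m" using assms(4) by (auto simp: has_motion_def)
  then have "infinite (moved V \<phi>)" using m_infinite ordIso_iff_ordLeq by blast
  moreover have "moved V \<phi> \<subseteq> V" by (auto simp: moved_def)
  ultimately have "infinite V" using finite_subset by blast
  then show ?thesis by (rule asymmetrizing_count)
qed

end
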